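(* Let $d\geq3$ be an integer, and let $\mathcal D\subset\mathbb{R}_{\geq0}^d$ be a bounded set with nonempty interior and boundary of Lebesgue measure zero. Then for any integer $k$ with $1\leq k\leq\lfloor\frac12d-1\rfloor$, $$\lim_{T\to\infty}\frac1{\#(\widehat{\mathbb{N}}^d\cap T\mathcal D)}\sum_{\boldsymbol a\in\widehat{\mathbb{N}}^d\cap T\mathcal D}\Bigl(\frac{f(\boldsymbol a)}{(a_1\cdots a_d)^{1/(d-1)}}\Bigr)^k=M_{d,k}.$$ If furthermore the closure $\overline{\mathcal D}$ satisfies $\overline{\mathcal D}\subset\mathbb{R}_{>0}^d$, then this limit relation holds for all integers $k$ with $1\leq k\leq d-2$.
   Context: $\widehat{\mathbb{N}}^d$ is the set of vectors $\boldsymbol a=(a_1,\ldots,a_d)$ with positive integer coefficients whose greatest common divisor is $1$. For $\boldsymbol a\in\widehat{\mathbb{N}}^d$, the Frobenius number $g(\boldsymbol a)$ is the largest integer which is not representable as a non-negative integer linear combination of $a_1,\ldots,a_d$, and $f(\boldsymbol a)=g(\boldsymbol a)+a_1+\cdots+a_d$. By a theorem of Marklof there is a unique continuous non-increasing function $\Psi_d:\mathbb{R}_{\geq0}\to\mathbb{R}_{\geq0}$ with $\Psi_d(0)=1$ such that for every bounded $\mathcal D\subset\mathbb{R}_{\geq0}^d$ with nonempty interior and boundary of Lebesgue measure zero and every $R\geq0$, $$\lim_{T\to\infty}\frac{\#\{\boldsymbol a\in\widehat{\mathbb{N}}^d\cap T\mathcal D : f(\boldsymbol a)/(a_1\cdots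 a_d)^{1/(d-1)}>R\}}{\#(\widehat{\mathbb{N}}^d\cap T\mathcal D)}=\Psi_d(R).$$ Equivalently (also by Marklof), $\Psi_d(R)=\mu_{d-1}(\{L\in X_{d-1} : \rho(L)>R\})$, where $X_n$ is the set of lattices $L\subset\mathbb{R}^n$ of covolume one, identified with $\mathrm{SL}(n,\mathbb{Z})\backslash\mathrm{SL}(n,\mathbb{R})$; $\mu_n$ is the $\mathrm{SL}(n,\mathbb{R})$-invariant probability measure on $X_n$; $\Delta=\{\boldsymbol x\in\mathbb{R}_{\geq0}^{d-1} : x_1+\cdots+x_{d-1}\leq1\}$; and $\rho(L)=\inf\{\rho>0 : L+\rho\Delta=\mathbb{R}^{d-1}\}$. For $k=1,\ldots,d-2$, $M_{d,k}$ denotes the (finite) $k$th moment of the limit distribution: $$M_{d,k}=-\int_0^\infty R^k\,d\Psi_d(R)=k\int_0^\infty R^{k-1}\Psi_d(R)\,dR.$$ *)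

theory Defs
  imports "HOL-Analysis.Analysis"
begin

text \<open>The dimension \<open>d\<close> is \<open>CARD('d)\<close>.\<close>

definition prim_vecs :: "(nat ^ 'd::finite) set" where
  "prim_vecs = {a. (\<forall>i. 0 < a $ i) \<and> Gcd (range (\<lambda>i. a $ i)) = 1}"

definition prim_vecs_in :: "(real ^ 'd::finite) set \<Rightarrow> (nat ^ 'd) set" where
  "prim_vecs_in S = {a \<in> prim_vecs. (\<chi> i. real (a $ i)) \<in> S}"

definition representable :: "nat ^ 'd::finite \<Rightarrow> int \<Rightarrow> bool" where
  "representable a n \<longleftrightarrow> (\<exists>c :: 'd \<Rightarrow> nat. n = (\<Sum>i\<in>UNIV. int (c i) * int (a $ i)))"

text \<open>Negative integers are never representable, so the value is \<open>-1\<close> when some \<open>a $ i\<close> is 1.\<close>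

definition frobenius_number :: "nat ^ 'd::finite \<Rightarrow> int" where
  "frobenius_number a = (GREATEST n. \<not> representable a n)"

definition frobenius_f :: "nat ^ 'd::finite \<Rightarrow> int" where
  "frobenius_f a = frobenius_number a + (\<Sum>i\<in>UNIV. int (a $ i))"

definition normalized_f :: "nat ^ 'd::finite \<Rightarrow> real" where
  "normalized_f a =
     real_of_int (frobenius_f a) / (\<Prod>i\<in>UNIV. real (a $ i)) powr (1 / (real CARD('d) - 1))"

definition admissible_domain :: "(real ^ 'd::finite) set \<Rightarrow> bool" where
  "admissible_domain D \<longleftrightarrow>
     D \<subseteq> {x. \<forall>i. 0 \<le> x $ i} \<and> bounded D \<and> interior D \<noteq> {} \<and> frontier D \<in> null_sets lebesgue"

text \<open>
  The characterization of Marklof's function \<open>\<Psi>\<^sub>d\<close>. Only the values of \<open>\<Psi>\<close> on \<open>{0..}\<close> are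
  constrained, and there they are unique by \<open>frobenius_limit_distribution_unique\<close> below.
\<close>

definition frobenius_limit_distribution :: "'d::finite itself \<Rightarrow> (real \<Rightarrow> real) \<Rightarrow> bool" where
  "frobenius_limit_distribution _ \<Psi> \<longleftrightarrow>
     continuous_on {0..} \<Psi> \<and> antimono_on {0..} \<Psi> \<and> (\<forall>R\<ge>0. 0 \<le> \<Psi> R) \<and> \<Psi> 0 = 1 \<and>
     (\<forall>D :: (real ^ 'd) set. admissible_domain D \<longrightarrow>
       (\<forall>R\<ge>0. ((\<lambda>T. real (card {a \<in> prim_vecs_in (scaleR T ` D). normalized_f a > R})
                     / real (card (prim_vecs_in (scaleR T ` D)))) \<longlongrightarrow> \<Psi> R) at_top))"

text \<open>The \<open>k\<close>th moment of the probability distribution on \<open>{0..}\<close> with tail function \<open>\<Psi>\<close>.\<close>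

definition limit_moment :: "(real \<Rightarrow> real) \<Rightarrow> nat \<Rightarrow> real" where
  "limit_moment \<Psi> k = real k * (LBINT R:{0..}. R ^ (k - 1) * \<Psi> R)"

lemma admissible_domain_unit_cube: "admissible_domain (cbox 0 1 :: (real ^ 'd::finite) set)"
proof -
  have "interior (cbox 0 1 :: (real ^ 'd) set) \<noteq> {}"
    by (simp add: box_ne_empty interior_cbox Basis_vec_def inner_axis)
  moreover have "frontier (cbox 0 1 :: (real ^ 'd) set) \<in> null_sets lebesgue"
    using negligible_convex_frontier[OF convex_box(1)] negligible_iff_null_sets by blast
  ultimately show ?thesis
    unfolding admissible_domain_def by (auto simp: mem_box_cart bounded_cbox)
qed

lemma frobenius_limit_distribution_unique:
  assumes "frobenius_limit_distribution TYPE('d::finite) \<Psi>"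
    and "frobenius_limit_distribution TYPE('d) \<Psi>'" and "0 \<le> R"
  shows "\<Psi> R = \<Psi>' R"
  using assms admissible_domain_unit_cube[where 'd = 'd]
  unfolding frobenius_limit_distribution_def
  by (meson tendsto_unique trivial_limit_at_top_linorder)

end

theory Submission
  imports Defs
begin

text \<open>
  Since convergence in distribution is the hypothesis, the moments converge by dominated convergence
  once the tails of \<open>normalized_f\<close> are bounded, uniformly in \<open>T\<close>, by \<open>B * R powr - (k + 1 / 4)\<close>.

  Let \<open>n = d - 1\<close> and let \<open>q = a $ i0\<close> be the largest entry of \<open>a\<close>. A Fejer kernel argument modulo
  \<open>q\<close> shows that either every residue is a combination of the remaining entries with coefficients
  below \<open>2 * H\<close>, so that \<open>frobenius_f a \<le> 2 * n * H * q\<close>, or some multiple \<open>j\<close> brings all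
  \<open>j * a $ i / q\<close> within \<open>C / H\<close> of integers: the points \<open>j * a / q\<close> modulo 1 form a group, so without
  such a \<open>j\<close> a cell of side \<open>C / H\<close> contains at most one of them, and the exponential sums decay
  quadratically in the cell index. By primitivity, \<open>gcd j q\<close> is then at most \<open>M = C * q / H\<close>, so for
  fixed \<open>j\<close> each entry has at most \<open>3 * M\<close> possible values. Hence \<open>frobenius_f a > R * q powr (d / n)\<close>
  holds for only \<open>O(Y ^ d / R ^ n)\<close> primitive vectors with entries at most \<open>Y\<close>.

  If the closure of \<open>D\<close> avoids the coordinate hyperplanes, \<open>q\<close> is comparable to every entry and this
  is the required tail bound. In general \<open>normalized_f a\<close> exceeds \<open>R\<close> only if
  \<open>frobenius_f a > sqrt R * q powr (d / n)\<close> or the ratio of \<open>q powr (d / n)\<close> to the normalization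
  exceeds \<open>sqrt R\<close>, which costs half of the decay exponent.
\<close>

section \<open>Residues represented with small coefficients\<close>

lemma sum_cis_mod:
  fixes m :: int and q :: nat
  assumes "q > 0"
  shows "(\<Sum>j<q. cis (2 * pi * (real j * of_int m / real q))) = (if int q dvd m then of_nat q else 0)"
proof -
  define z where "z = cis (2 * pi * (of_int m / real q))"
  have pow: "cis (2 * pi * (real j * of_int m / real q)) = z ^ j" for j
    unfolding z_def Complex.DeMoivre by (rule arg_cong[where f = cis]) simp
  have zq: "z ^ q = 1"
    unfolding z_def Complex.DeMoivre using assms cis_multiple_2pi[of "of_int m"] by (simp add: mult_ac)
  have z1: "z = 1 \<longleftrightarrow> int q dvd m"
  proof
    assume "z = 1"
    then have "cos (2 * pi * (of_int m / real q)) = 1"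
      unfolding z_def by (metis cis.simps(1) one_complex.simps(1))
    then obtain x :: int where "2 * pi * (of_int m / real q) = of_int x * 2 * pi"
      using cos_one_2pi_int by blast
    then have "real_of_int m = of_int (x * int q)"
      using assms by (simp add: field_simps)
    then show "int q dvd m" by (metis dvd_triv_right of_int_eq_iff)
  next
    assume "int q dvd m"
    then obtain x where "m = int q * x" by blast
    then show "z = 1" unfolding z_def using assms cis_multiple_2pi[of "of_int x"] by simp
  qed
  show ?thesis
  proof (cases "z = 1")
    case True
    then show ?thesis using z1 unfolding pow by simp
  next
    case False
    then show ?thesis using z1 zq geometric_sum[of z q] unfolding pow by simp
  qed
qed

text \<open>The norm equals 2 * |sin (pi * x)|. On [0, 1.6], which contains [0, pi / 2], the Taylor
  bound gives sin y >= y / 2, and pi * |x| >= 2 * |x|. The constant 2 is not sharp, but it cancels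
  against the bound 2 for the norm of \<open>z ^ H - 1\<close> in the geometric sum.\<close>

lemma norm_cis_minus_1_ge:
  assumes "\<bar>x\<bar> \<le> 1 / 2"
  shows "2 * \<bar>x\<bar> \<le> norm (cis (2 * pi * x) - 1)"
proof -
  define y where "y = pi * \<bar>x\<bar>"
  have "y \<le> 3.2 * (1 / 2)"
    unfolding y_def using assms pi_approx by (intro mult_mono) auto
  then have y: "0 \<le> y" "y \<le> 1.6" by (auto simp: y_def)
  have "\<bar>sin y - (\<Sum>m<3. sin_coeff m * y ^ m)\<bar> \<le> inverse (fact 3) * \<bar>y\<bar> ^ 3"
    by (rule Maclaurin_sin_bound)
  then have "\<bar>sin y - y\<bar> \<le> y ^ 3 / 6"
    using y by (simp add: eval_nat_numeral sin_coeff_def fact_numeral)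
  then have "sin y \<ge> y - y ^ 3 / 6" by linarith
  \<comment> \<open>2.56 is the square of 1.6, and 2.56 / 6 < 1 / 2, so the cubic term costs less
    than half of \<open>y\<close>.\<close>
  moreover have "y ^ 3 \<le> 2.56 * y"
  proof -
    have "y * y \<le> 1.6 * 1.6" using y by (intro mult_mono) auto
    then have "y * (y * y) \<le> y * 2.56" using y by (intro mult_left_mono) auto
    then show ?thesis by (simp add: power3_eq_cube mult_ac)
  qed
  ultimately have sy: "sin y \<ge> y / 2" using y by simp
  have "y \<ge> 2 * \<bar>x\<bar>" unfolding y_def using pi_approx by (intro mult_right_mono) auto
  then have *: "\<bar>x\<bar> \<le> sin y" using sy by simp
  have "sin (pi * x) ^ 2 = sin y ^ 2" unfolding y_def by (cases "x \<ge> 0") auto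
  moreover have "norm (cis (2 * pi * x) - 1) ^ 2 = (2 * sin (pi * x)) ^ 2"
    unfolding cmod_power2 using cos_double_sin[of "pi * x"] sin_cos_squared_add[of "2 * pi * x"]
    by (simp add: power2_eq_square algebra_simps)
  ultimately have "norm (cis (2 * pi * x) - 1) ^ 2 = (2 * sin y) ^ 2" by (simp add: power_mult_distrib)
  moreover have "(2 * \<bar>x\<bar>) ^ 2 \<le> (2 * sin y) ^ 2"
    using * by (intro power_mono) auto
  ultimately show ?thesis by (metis norm_ge_zero power2_le_imp_le)
qed

text \<open>Only the distance of \<open>x\<close> from an integer matters. The geometric series is
  \<open>z ^ H - 1\<close>, of norm at most 2, divided by \<open>z - 1\<close>, whose norm is at
  least twice that distance; hence a bound independent of \<open>H\<close>.\<close>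

lemma norm_sum_cis_le:
  fixes H :: nat
  assumes "\<bar>x - of_int k\<bar> \<le> 1 / 2"
  shows "\<bar>x - of_int k\<bar> * norm (\<Sum>b<H. cis (2 * pi * (real b * x))) \<le> 1"
proof -
  define y where "y = x - of_int k"
  define z where "z = cis (2 * pi * y)"
  have "cis (2 * pi * x) = cis (2 * pi * of_int k + 2 * pi * y)"
    by (simp add: y_def algebra_simps)
  also have "\<dots> = z" unfolding cis_mult[symmetric] using cis_multiple_2pi[of "of_int k"] by (simp add: z_def)
  finally have z: "cis (2 * pi * x) = z" .
  have pow: "cis (2 * pi * (real b * x)) = z ^ b" for b
    unfolding z[symmetric] Complex.DeMoivre by (rule arg_cong[where f = cis]) simp
  have "(z - 1) * (\<Sum>b<H. z ^ b) = z ^ H - 1"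
    using power_diff_1_eq[of z H] by simp
  then have "norm (z - 1) * norm (\<Sum>b<H. z ^ b) = norm (z ^ H - 1)"
    by (metis norm_mult)
  also have "\<dots> \<le> 2"
    using norm_triangle_ineq4[of "z ^ H" 1] by (simp add: z_def norm_power)
  finally have "norm (z - 1) * norm (\<Sum>b<H. z ^ b) \<le> 2" .
  moreover have "2 * \<bar>y\<bar> * norm (\<Sum>b<H. z ^ b) \<le> norm (z - 1) * norm (\<Sum>b<H. z ^ b)"
    using norm_cis_minus_1_ge[of y] assms by (intro mult_right_mono) (auto simp: y_def z_def)
  ultimately show ?thesis by (simp add: pow y_def)
qed

text \<open>Each squared exponential sum has nonnegative Fourier coefficients supported in
  \<open>[1 - H, H - 1]\<close>.\<close>
lemma norm_sum_cis_sq: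
  "complex_of_real (norm (\<Sum>b<H. cis (2 * pi * (real b * x))) ^ 2) =
     (\<Sum>(b, b') \<in> {..<H} \<times> {..<H}. cis (2 * pi * ((real b - real b') * x)))"
proof -
  have "complex_of_real (norm (\<Sum>b<H. cis (2 * pi * (real b * x))) ^ 2) =
      (\<Sum>b<H. cis (2 * pi * (real b * x))) * (\<Sum>b<H. cis (- (2 * pi * (real b * x))))"
    unfolding complex_norm_square cnj_sum cis_cnj ..
  also have "\<dots> = (\<Sum>(b, b') \<in> {..<H} \<times> {..<H}. cis (2 * pi * ((real b - real b') * x)))"
    by (simp add: sum_product sum.cartesian_product cis_mult algebra_simps)
  finally show ?thesis .
qed

section \<open>The Fejer kernel argument for missed residues\<close>

text \<open>By orthogonality of characters, the sum over all \<open>j\<close> of these products,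
  twisted by a phase, is \<open>q\<close> times the number of ways to reach a shifted residue with
  coefficients \<open>b - b'\<close>. If \<open>r\<close> is missed this is 0, so the terms with
  \<open>j > 0\<close> must outweigh the term at \<open>j = 0\<close>, which is the left-hand
  side.\<close>

lemma missed_residue_sum_ge:
  fixes q H :: nat and a :: "'i \<Rightarrow> nat" and r :: int
  assumes "finite I" "q > 0"
    and miss: "\<And>c. (\<forall>i\<in>I. c i \<le> 2 * (H - 1)) \<Longrightarrow> \<not> int q dvd (\<Sum>i\<in>I. int (c i) * int (a i)) - r"
  shows "(real H ^ 2) ^ card I \<le>
    (\<Sum>j\<in>{1..<q}. \<Prod>i\<in>I. norm (\<Sum>b<H. cis (2 * pi * (real b * (real j * real (a i) / real q)))) ^ 2)"
proof -
  let ?P = "\<lambda>j. \<Prod>i\<in>I. norm (\<Sum>b<H. cis (2 * pi * (real b * (real j * real (a i) / real q)))) ^ 2"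
  \<comment> \<open>Adding \<open>H - 1\<close> to each difference \<open>b - b'\<close> turns it
    into a coefficient between 0 and \<open>2 * (H - 1)\<close> and moves the target from
    \<open>s\<close> to \<open>r\<close>.\<close>
  define s :: int where "s = r - (\<Sum>i\<in>I. int (H - 1) * int (a i))"
  let ?e = "\<lambda>j. cis (- (2 * pi * (real j * of_int s / real q)))"
  define F where "F = PiE I (\<lambda>_. {..<H} \<times> {..<H})"
  define v where "v p = (\<Sum>i\<in>I. (int (fst (p i)) - int (snd (p i))) * int (a i)) - s"
    for p :: "'i \<Rightarrow> nat \<times> nat"
  have cis_sum: "(\<Prod>i\<in>I. cis (g i)) = cis (\<Sum>i\<in>I. g i)" for g
    using \<open>finite I\<close> by induction (auto simp: cis_mult)
  have P: "?e j * of_real (?P j) = (\<Sum>p\<in>F. cis (2 * pi * (real j * of_int (v p) / real q)))" for j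
  proof -
    have "complex_of_real (?P j) = (\<Prod>i\<in>I. \<Sum>b\<in>{..<H} \<times> {..<H}.
        cis (2 * pi * ((real (fst b) - real (snd b)) * (real j * real (a i) / real q))))"
      unfolding of_real_prod norm_sum_cis_sq by (simp add: case_prod_unfold)
    also have "\<dots> = (\<Sum>p\<in>F. \<Prod>i\<in>I.
        cis (2 * pi * ((real (fst (p i)) - real (snd (p i))) * (real j * real (a i) / real q))))"
      unfolding F_def using \<open>finite I\<close> by (intro prod_sum_PiE) auto
    also have "\<dots> = (\<Sum>p\<in>F. cis (2 * pi * (real j * of_int (v p + s) / real q)))"
      unfolding cis_sum v_def
      by (simp add: sum_distrib_left sum_divide_distrib mult_ac)
    finally show ?thesis
      by (simp add: sum_distrib_left cis_mult algebra_simps add_divide_distrib)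
  qed
  have "(\<Sum>j<q. ?e j * of_real (?P j)) = (\<Sum>p\<in>F. \<Sum>j<q. cis (2 * pi * (real j * of_int (v p) / real q)))"
    unfolding P by (rule sum.swap)
  also have "\<dots> = (\<Sum>p\<in>F. 0)"
  proof (intro sum.cong refl)
    fix p assume p: "p \<in> F"
    \<comment> \<open>For \<open>i\<close> in \<open>I\<close> the subtraction of naturals does not
      truncate, because \<open>snd (p i) < H\<close>.\<close>
    define c where "c i = (H - 1) + fst (p i) - snd (p i)" for i
    have ci: "int (c i) = int (H - 1) + int (fst (p i)) - int (snd (p i)) \<and> c i \<le> 2 * (H - 1)" if "i \<in> I" for i
    proof -
      have "p i \<in> {..<H} \<times> {..<H}" using p that by (auto simp: F_def)
      then have "fst (p i) < H" "snd (p i) < H" by auto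
      then show ?thesis unfolding c_def by auto
    qed
    have "(\<Sum>i\<in>I. int (c i) * int (a i)) =
        (\<Sum>i\<in>I. (int (fst (p i)) - int (snd (p i))) * int (a i) + int (H - 1) * int (a i))"
    proof (intro sum.cong refl)
      fix i assume "i \<in> I"
      then have "int (c i) = int (fst (p i)) - int (snd (p i)) + int (H - 1)" using ci by auto
      then show "int (c i) * int (a i) =
          (int (fst (p i)) - int (snd (p i))) * int (a i) + int (H - 1) * int (a i)"
        by (simp only: distrib_right)
    qed
    then have "v p = (\<Sum>i\<in>I. int (c i) * int (a i)) - r"
      unfolding v_def s_def by (simp add: sum.distrib)
    then have "\<not> int q dvd v p" using miss[of c] ci by auto
    then show "(\<Sum>j<q. cis (2 * pi * (real j * of_int (v p) / real q))) = 0"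
      using sum_cis_mod[OF \<open>q > 0\<close>] by simp
  qed
  finally have 0: "(\<Sum>j<q. ?e j * of_real (?P j)) = 0" by simp
  have "{..<q} = insert 0 {1..<q}" using \<open>q > 0\<close> by auto
  then have "?e 0 * of_real (?P 0) + (\<Sum>j\<in>{1..<q}. ?e j * of_real (?P j)) = 0"
    using 0 by simp
  then have "complex_of_real (?P 0) = - (\<Sum>j\<in>{1..<q}. ?e j * of_real (?P j))"
    by (simp add: add_eq_0_iff)
  then have "norm (complex_of_real (?P 0)) \<le> (\<Sum>j\<in>{1..<q}. norm (?e j * of_real (?P j)))"
    using norm_sum[of "\<lambda>j. ?e j * of_real (?P j)" "{1..<q}"] by simp
  also have "\<dots> = (\<Sum>j\<in>{1..<q}. ?P j)"
    by (intro sum.cong refl) (simp add: norm_mult prod_nonneg del: of_real_prod)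
  finally show ?thesis by (simp add: norm_power prod_norm[symmetric] del: of_real_prod)
qed

text \<open>Telescoping. The step from \<open>W = 0\<close> is treated apart, since there
  \<open>1 / real W\<close> is 0.\<close>

lemma sum_inverse_squares_le: "(\<Sum>w<W. 1 / (real w + 1) ^ 2) \<le> 2 - 1 / real W"
proof (induction W)
  case (Suc W)
  have "1 / (real W + 1) ^ 2 \<le> 1 / real W - 1 / (real W + 1)" if "W > 0"
    using that by (simp add: divide_simps power2_eq_square)
  then show ?case using Suc by (cases "W = 0") (auto simp: add_ac)
qed auto

text \<open>The unit mass at \<open>-1\<close> and \<open>0\<close> accounts for the cells adjacent to the origin.\<close>
definition cell_weight :: "real \<Rightarrow> int \<Rightarrow> real" where
  "cell_weight e m =
     (if m = 0 \<or> m = -1 then 1 else e / (if m \<ge> 0 then real_of_int m else - real_of_int m - 1) ^ 2)"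

lemma cell_weight_nonneg: "e \<ge> 0 \<Longrightarrow> cell_weight e m \<ge> 0"
  by (simp add: cell_weight_def)

text \<open>Reflecting \<open>m\<close> to \<open>- 1 - m\<close> preserves the weight; each half is
  a unit mass plus \<open>e\<close> times a sum of inverse squares.\<close>

lemma sum_cell_weight_le:
  assumes "e \<ge> 0"
  shows "(\<Sum>m\<in>{- int W..<int W}. cell_weight e m) \<le> 2 + 4 * e"
proof -
  have half: "(\<Sum>w<W. cell_weight e (int w)) \<le> 1 + 2 * e"
  proof (cases W)
    case (Suc V)
    have "(\<Sum>w<W. cell_weight e (int w)) = cell_weight e 0 + (\<Sum>w<V. cell_weight e (int (Suc w)))"
      unfolding Suc sum.lessThan_Suc_shift by simp
    also have "\<dots> = 1 + e * (\<Sum>w<V. 1 / (real w + 1) ^ 2)"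
      by (simp add: cell_weight_def sum_distrib_left add_ac)
    also have "\<dots> \<le> 1 + e * 2"
      using sum_inverse_squares_le[of V] assms by (intro add_mono mult_left_mono) (auto intro: order_trans)
    finally show ?thesis by simp
  qed (use assms in auto)
  have un: "{- int W..<int W} = int ` {..<W} \<union> (\<lambda>w. - 1 - int w) ` {..<W}"
  proof (intro equalityI subsetI)
    fix m assume m: "m \<in> {- int W..<int W}"
    show "m \<in> int ` {..<W} \<union> (\<lambda>w. - 1 - int w) ` {..<W}"
    proof (cases "m \<ge> 0")
      case True
      then show ?thesis using m by (auto intro!: image_eqI[of _ _ "nat m"])
    next
      case False
      then show ?thesis using m by (auto intro!: image_eqI[of _ "\<lambda>w. - 1 - int w" "nat (- 1 - m)"])
    qed
  qed auto
  have "(\<Sum>m\<in>{- int W..<int W}. cell_weight e m) =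
      (\<Sum>m\<in>int ` {..<W}. cell_weight e m) + (\<Sum>m\<in>(\<lambda>w. - 1 - int w) ` {..<W}. cell_weight e m)"
    unfolding un by (rule sum.union_disjoint) auto
  also have "\<dots> = (\<Sum>w<W. cell_weight e (int w)) + (\<Sum>w<W. cell_weight e (- 1 - int w))"
    by (simp add: sum.reindex inj_on_def)
  also have "(\<Sum>w<W. cell_weight e (- 1 - int w)) = (\<Sum>w<W. cell_weight e (int w))"
    by (intro sum.cong refl) (auto simp: cell_weight_def)
  finally show ?thesis using half by simp
qed

text \<open>Space is cut into cells of side \<open>C / H\<close>. Modulo integers, the difference of
  the points with indices \<open>j < l\<close> is the point with index \<open>l - j\<close>, so
  \<open>sep\<close> forces distinct points into distinct cells and keeps all of them out of the
  \<open>2 ^ card I\<close> cells around the origin. Summing the cellwise bound over all remaining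
  cells factors over the coordinates.\<close>

lemma sum_prod_exponential_sums_le:
  fixes q H :: nat and a :: "'i \<Rightarrow> nat" and C :: real
  assumes "finite I" "q > 0" "H > 0" "C \<ge> 1"
    and sep: "\<And>j. j \<in> {1..<q} \<Longrightarrow> \<exists>i\<in>I. \<forall>k::int. C / real H < \<bar>real j * real (a i) / real q - of_int k\<bar>"
  shows "(\<Sum>j\<in>{1..<q}. \<Prod>i\<in>I. norm (\<Sum>b<H. cis (2 * pi * (real b * (real j * real (a i) / real q)))) ^ 2)
    \<le> (real H ^ 2) ^ card I * ((2 + 4 / C ^ 2) ^ card I - 2 ^ card I)"
proof -
  define e where "e = 1 / C ^ 2"
  define \<delta> where "\<delta> = C / real H"
  define \<theta> where "\<theta> j i = real j * real (a i) / real q - of_int (round (real j * real (a i) / real q))" for j i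
  define S where "S j i = norm (\<Sum>b<H. cis (2 * pi * (real b * (real j * real (a i) / real q))))" for j i
  define m where "m j = restrict (\<lambda>i. \<lfloor>\<theta> j i / \<delta>\<rfloor>) I" for j
  \<comment> \<open>Because \<open>\<theta> j i / \<delta>\<close> lies strictly between
    \<open>- (1 / \<delta>)\<close> and \<open>1 / \<delta>\<close>, every cell index lies in
    \<open>{- int W..<int W}\<close>.\<close>
  define W where "W = nat \<lceil>1 / \<delta>\<rceil>"
  have e: "e \<ge> 0" by (simp add: e_def)
  have \<delta>: "\<delta> > 0" using assms by (simp add: \<delta>_def)
  have \<theta>: "\<bar>\<theta> j i\<bar> \<le> 1 / 2" for j i
    unfolding \<theta>_def using of_int_round_abs_le[of "real j * real (a i) / real q"] by (simp add: abs_minus_commute)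
  have S_le: "S j i \<le> real H" for j i
    unfolding S_def by (rule order_trans[OF norm_sum]) simp
  have S_nonneg: "0 \<le> S j i" for j i by (simp add: S_def)
  have \<theta>S: "\<bar>\<theta> j i\<bar> * S j i \<le> 1" for j i
    unfolding \<theta>_def S_def by (rule norm_sum_cis_le) (rule \<theta>[unfolded \<theta>_def])
  have floor: "of_int \<lfloor>\<theta> j i / \<delta>\<rfloor> * \<delta> \<le> \<theta> j i" "\<theta> j i < (of_int \<lfloor>\<theta> j i / \<delta>\<rfloor> + 1) * \<delta>" for j i
  proof -
    have "\<theta> j i = (\<theta> j i / \<delta>) * \<delta>" using \<delta> by simp
    then show "of_int \<lfloor>\<theta> j i / \<delta>\<rfloor> * \<delta> \<le> \<theta> j i" "\<theta> j i < (of_int \<lfloor>\<theta> j i / \<delta>\<rfloor> + 1) * \<delta>"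
      using \<delta> by (metis less_eq_real_def mult_right_mono of_int_floor_le,
        metis mult_strict_right_mono real_of_int_floor_add_one_gt)
  qed
  have S_cell: "S j i ^ 2 \<le> real H ^ 2 * cell_weight e (m j i)" if "i \<in> I" for j i
  proof (cases "m j i = 0 \<or> m j i = -1")
    case True
    then show ?thesis using S_le[of j i] S_nonneg[of j i] by (auto simp: cell_weight_def power_mono)
  next
    case False
    \<comment> \<open>\<open>w * \<delta>\<close> is the distance from 0 to the cell containing
      \<open>\<theta> j i\<close>.\<close>
    define w where "w = (if m j i \<ge> 0 then real_of_int (m j i) else - real_of_int (m j i) - 1)"
    have w: "w > 0" using False unfolding w_def by auto
    have "w * \<delta> \<le> \<bar>\<theta> j i\<bar>"
      using floor[of j i] that by (auto simp: w_def m_def algebra_simps)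
    then have "w * \<delta> * S j i \<le> 1"
      using \<theta>S[of j i] S_nonneg[of j i] by (meson mult_right_mono order_trans)
    then have "S j i \<le> real H * (1 / (C * w))"
      using w \<open>C \<ge> 1\<close> \<open>H > 0\<close> by (simp add: \<delta>_def field_simps)
    then have "S j i ^ 2 \<le> (real H * (1 / (C * w))) ^ 2" using S_nonneg by (intro power_mono)
    also have "\<dots> = real H ^ 2 * cell_weight e (m j i)"
      using False by (simp add: cell_weight_def w_def e_def power_mult_distrib power_divide)
    finally show ?thesis .
  qed
  have inj: "inj_on m {1..<q}"
  proof (rule linorder_inj_onI')
    fix j l assume jl: "j \<in> {1..<q}" "l \<in> {1..<q}" "j < l"
    then obtain i where i: "i \<in> I"
      and sep_i: "\<And>k::int. \<delta> < \<bar>real (l - j) * real (a i) / real q - of_int k\<bar>"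
    proof -
      have "l - j \<in> {1..<q}" using jl by auto
      from sep[OF this] show ?thesis using that unfolding \<delta>_def by blast
    qed
    \<comment> \<open>The integer in \<open>sep_i\<close> is taken to be the difference of the two
      rounded values. Two numbers in the same half-open cell would differ by less than
      \<open>\<delta>\<close>.\<close>
    have "\<delta> < \<bar>\<theta> l i - \<theta> j i\<bar>"
      using sep_i[of "round (real l * real (a i) / real q) - round (real j * real (a i) / real q)"] jl
      by (simp add: \<theta>_def of_nat_diff algebra_simps diff_divide_distrib)
    then have "\<lfloor>\<theta> l i / \<delta>\<rfloor> \<noteq> \<lfloor>\<theta> j i / \<delta>\<rfloor>"
      using floor[of j i] floor[of l i] by (auto simp: algebra_simps)
    then show "m j \<noteq> m l" using i unfolding m_def by (metis restrict_apply')
  qed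
  have range: "m j \<in> PiE I (\<lambda>_. {- int W..<int W}) - PiE I (\<lambda>_. {-1, 0})" if j: "j \<in> {1..<q}" for j
  proof
    have "- int W \<le> \<lfloor>\<theta> j i / \<delta>\<rfloor> \<and> \<lfloor>\<theta> j i / \<delta>\<rfloor> < int W" for i
    proof -
      have "1 / \<delta> > 0" using \<delta> by simp
      then have *: "real_of_int (int W) \<ge> 1 / \<delta>" unfolding W_def by linarith
      have "- (1 / \<delta>) < \<theta> j i / \<delta>" "\<theta> j i / \<delta> < 1 / \<delta>"
        using \<theta>[of j i] \<delta> by (auto simp: field_simps)
      then show ?thesis using * by (auto simp: le_floor_iff floor_less_iff)
    qed
    then show "m j \<in> PiE I (\<lambda>_. {- int W..<int W})" by (auto simp: m_def)
    \<comment> \<open>With the rounded value as the integer, \<open>sep\<close> places this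
      coordinate outside the cells \<open>-1\<close> and \<open>0\<close>, whose union is
      [-\<delta>, \<delta>).\<close>
    obtain i where i: "i \<in> I" and "\<delta> < \<bar>\<theta> j i\<bar>"
      using sep[OF j] unfolding \<delta>_def \<theta>_def by blast
    then have "m j i \<noteq> 0" "m j i \<noteq> -1"
      using floor[of j i] \<delta> unfolding m_def by (auto simp: algebra_simps)
    then show "m j \<notin> PiE I (\<lambda>_. {-1, 0})" using i by (auto simp: PiE_iff)
  qed
  have box_sum: "(\<Sum>p\<in>PiE I (\<lambda>_. A). \<Prod>i\<in>I. cell_weight e (p i)) = (\<Sum>m\<in>A. cell_weight e m) ^ card I"
    if "finite A" for A
    using prod_sum_PiE[OF \<open>finite I\<close>, of "\<lambda>_. A" "\<lambda>_. cell_weight e"] that by simp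
  have W: "W > 0" using \<delta> by (simp add: W_def)
  have "(\<Sum>j\<in>{1..<q}. \<Prod>i\<in>I. S j i ^ 2) \<le> (\<Sum>j\<in>{1..<q}. \<Prod>i\<in>I. real H ^ 2 * cell_weight e (m j i))"
    using S_cell by (intro sum_mono prod_mono) auto
  also have "\<dots> = (real H ^ 2) ^ card I * (\<Sum>j\<in>{1..<q}. \<Prod>i\<in>I. cell_weight e (m j i))"
    by (simp add: prod.distrib sum_distrib_left)
  also have "(\<Sum>j\<in>{1..<q}. \<Prod>i\<in>I. cell_weight e (m j i)) = (\<Sum>p\<in>m ` {1..<q}. \<Prod>i\<in>I. cell_weight e (p i))"
    by (simp only: sum.reindex[OF inj] o_def)
  \<comment> \<open>The occupied cells are distinct and the weights nonnegative, so the sum may run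
    over all cells outside the central block.\<close>
  also have "\<dots> \<le> (\<Sum>p\<in>PiE I (\<lambda>_. {- int W..<int W}) - PiE I (\<lambda>_. {-1, 0}). \<Prod>i\<in>I. cell_weight e (p i))"
  proof (rule sum_mono2)
    show "m ` {1..<q} \<subseteq> PiE I (\<lambda>_. {- int W..<int W}) - PiE I (\<lambda>_. {-1, 0})" using range by blast
  qed (auto intro!: prod_nonneg cell_weight_nonneg[OF e] finite_PiE \<open>finite I\<close>)
  also have "\<dots> = (\<Sum>p\<in>PiE I (\<lambda>_. {- int W..<int W}). \<Prod>i\<in>I. cell_weight e (p i))
      - (\<Sum>p\<in>PiE I (\<lambda>_. {-1, 0}). \<Prod>i\<in>I. cell_weight e (p i))"
    using W \<open>finite I\<close> by (intro sum_diff PiE_mono) (auto intro!: finite_PiE)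
  also have "\<dots> = (\<Sum>m\<in>{- int W..<int W}. cell_weight e m) ^ card I - (\<Sum>m\<in>{-1, 0}. cell_weight e m) ^ card I"
    by (simp only: box_sum finite_atLeastLessThan_int finite.intros)
  also have "\<dots> \<le> (2 + 4 * e) ^ card I - 2 ^ card I"
    using sum_cell_weight_le[OF e, of W] cell_weight_nonneg[OF e]
    by (auto simp: cell_weight_def[of _ 0] cell_weight_def[of _ "-1"] intro!: power_mono sum_nonneg)
  finally show ?thesis by (simp add: S_def e_def mult_left_mono)
qed

text \<open>A missed residue makes the two preceding bounds yield 1 <= (2 + 4 / C ^ 2) ^ n - 2 ^ n.
  The right side tends to 0 as \<open>C\<close> grows, so some \<open>C\<close> depending on
  \<open>n\<close> alone excludes this.\<close>

theorem residues_covered: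
  fixes n :: nat
  obtains C :: real where "C \<ge> 1"
    and "\<And>I q H a r. finite (I :: 'i set) \<Longrightarrow> card I = n \<Longrightarrow> q > 0 \<Longrightarrow> H > 0 \<Longrightarrow>
      (\<And>j. j \<in> {1..<q} \<Longrightarrow> \<exists>i\<in>I. \<forall>k::int. C / real H < \<bar>real j * real (a i) / real q - of_int k\<bar>) \<Longrightarrow>
      \<exists>c. (\<forall>i\<in>I. c i \<le> 2 * (H - 1)) \<and> int q dvd (\<Sum>i\<in>I. int (c i) * int (a i :: nat)) - r"
proof -
  have "((\<lambda>C::real. (2 + 4 / C ^ 2) ^ n - 2 ^ n) \<longlongrightarrow> (2 + 0) ^ n - 2 ^ n) at_top"
    by (intro tendsto_intros real_tendsto_divide_at_top filterlim_pow_at_top filterlim_ident) auto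
  then have "\<forall>\<^sub>F C::real in at_top. (2 + 4 / C ^ 2) ^ n - 2 ^ n < 1"
    by (rule order_tendstoD) simp
  then obtain C :: real where C: "C \<ge> 1" "(2 + 4 / C ^ 2) ^ n - 2 ^ n < 1"
    using eventually_conj[OF eventually_ge_at_top[of 1]] eventually_happens'[of at_top]
    by (metis (no_types, lifting) trivial_limit_at_top_linorder)
  show thesis
  proof (rule that[OF C(1)], rule ccontr)
    fix I :: "'i set" and q H a r
    assume I: "finite I" "card I = n" and q: "q > 0" "H > 0"
      and sep: "\<And>j. j \<in> {1..<q} \<Longrightarrow> \<exists>i\<in>I. \<forall>k::int. C / real H < \<bar>real j * real (a i) / real q - of_int k\<bar>"
      and "\<nexists>c. (\<forall>i\<in>I. c i \<le> 2 * (H - 1)) \<and> int q dvd (\<Sum>i\<in>I. int (c i) * int (a i)) - r"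
    then have miss: "\<not> int q dvd (\<Sum>i\<in>I. int (c i) * int (a i)) - r"
      if "\<forall>i\<in>I. c i \<le> 2 * (H - 1)" for c using that by blast
    have "(real H ^ 2) ^ n \<le> (real H ^ 2) ^ n * ((2 + 4 / C ^ 2) ^ n - 2 ^ n)"
      using missed_residue_sum_ge[OF I(1) q(1) miss]
        sum_prod_exponential_sums_le[OF I(1) q C(1) sep] unfolding I(2) by (rule order_trans)
    also have "\<dots> < (real H ^ 2) ^ n * 1"
      using C(2) q by (intro mult_strict_left_mono) auto
    finally show False by simp
  qed
qed

section \<open>From covered residues to the Frobenius number\<close>

lemma representable_nonneg: "representable a m \<Longrightarrow> m \<ge> 0"
  unfolding representable_def by (auto intro: sum_nonneg)

text \<open>All negative integers are non-representable, so cutting off below -1 leaves a finite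
  nonempty set with the same greatest element. This is what makes \<open>GREATEST\<close> well
  defined.\<close>

lemma frobenius_number_bounds:
  fixes a :: "nat ^ 'd::finite"
  assumes "\<And>m. m > B \<Longrightarrow> representable a m"
  shows "-1 \<le> frobenius_number a" "frobenius_number a \<le> B"
proof -
  define S where "S = {m. -1 \<le> m \<and> \<not> representable a m}"
  have "-1 \<in> S" using representable_nonneg[of a "-1"] by (auto simp: S_def)
  have "S \<subseteq> {-1..B}" using assms unfolding S_def by (auto simp: not_less[symmetric])
  then have fin: "finite S" by (rule finite_subset) simp
  have Max_S: "Max S \<in> S" using fin \<open>-1 \<in> S\<close> by (intro Max_in) auto
  have "frobenius_number a = Max S"
    unfolding frobenius_number_def
  proof (rule Greatest_equality)
    show "\<not> representable a (Max S)" using Max_S by (simp add: S_def)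
    fix m assume m: "\<not> representable a m"
    show "m \<le> Max S"
    proof (cases "m \<ge> -1")
      case True
      then show ?thesis using m fin by (intro Max_ge) (auto simp: S_def)
    next
      case False
      then show ?thesis using Max_S by (auto simp: S_def)
    qed
  qed
  then show "-1 \<le> frobenius_number a" "frobenius_number a \<le> B"
    using Max_S \<open>S \<subseteq> {-1..B}\<close> by (auto simp: S_def)
qed

text \<open>Says that the point \<open>j * a / q\<close> of the dual of the lattice of relations modulo \<open>q = a $ i0\<close> is
  within \<open>\<delta>\<close> of an integer point.\<close>
definition obstructed :: "real \<Rightarrow> nat ^ 'd::finite \<Rightarrow> 'd \<Rightarrow> nat \<Rightarrow> bool" where
  "obstructed \<delta> a i0 j \<longleftrightarrow> (\<forall>i. i \<noteq> i0 \<longrightarrow> (\<exists>k::int. \<bar>real j * real (a $ i) / real (a $ i0) - of_int k\<bar> \<le> \<delta>))"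

text \<open>A bounded combination congruent to \<open>m\<close> exceeds \<open>m\<close> by a
  multiple of \<open>a $ i0\<close>, which for \<open>m\<close> this large is below
  \<open>a $ i0\<close> and hence not positive. The deficit is filled with copies of
  \<open>a $ i0\<close>.\<close>

lemma representable_of_residues_covered:
  fixes a :: "nat ^ 'd::finite"
  assumes pos: "a $ i0 > 0"
    and cov: "\<And>r. \<exists>c. (\<forall>i\<in>- {i0}. c i \<le> K) \<and>
      int (a $ i0) dvd (\<Sum>i\<in>- {i0}. int (c i) * int (a $ i)) - r"
    and m: "m > int K * (\<Sum>i\<in>- {i0}. int (a $ i)) - int (a $ i0)"
  shows "representable a m"
proof -
  obtain c where c: "\<forall>i\<in>- {i0}. c i \<le> K"
    and "int (a $ i0) dvd (\<Sum>i\<in>- {i0}. int (c i) * int (a $ i)) - m"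
    using cov by blast
  then obtain t where t: "(\<Sum>i\<in>- {i0}. int (c i) * int (a $ i)) - m = int (a $ i0) * t" by blast
  have "(\<Sum>i\<in>- {i0}. int (c i) * int (a $ i)) \<le> int K * (\<Sum>i\<in>- {i0}. int (a $ i))"
    unfolding sum_distrib_left using c by (intro sum_mono mult_right_mono) auto
  then have "int (a $ i0) * t < int (a $ i0) * 1" using t m by linarith
  then have "t \<le> 0" using pos by (simp add: mult_less_cancel_left)
  have "m = (\<Sum>i\<in>UNIV. int ((c(i0 := nat (- t))) i) * int (a $ i))"
    unfolding sum.remove[OF finite UNIV_I[of i0]] using t \<open>t \<le> 0\<close>
    by (simp add: Compl_eq_Diff_UNIV algebra_simps)
  then show ?thesis unfolding representable_def by blast
qed

text \<open>Each \<open>j * a $ i\<close> differs from a multiple of \<open>q\<close> by at most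
  \<open>\<delta> * q\<close>, and the difference is divisible by \<open>gcd j q\<close>. Were the
  gcd larger than \<open>\<delta> * q\<close>, all differences would vanish; then \<open>q\<close>
  would divide every \<open>j * a $ i\<close>, hence \<open>j\<close> by primitivity, although
  \<open>0 < j < q\<close>.\<close>

lemma obstructed_imp_large:
  fixes a :: "nat ^ 'd::finite"
  assumes a: "a \<in> prim_vecs" and j: "j \<in> {1..<a $ i0}" and obs: "obstructed \<delta> a i0 j"
  shows "real (gcd j (a $ i0)) \<le> \<delta> * real (a $ i0)"
proof (rule ccontr)
  define q where "q = a $ i0"
  assume neg: "\<not> real (gcd j (a $ i0)) \<le> \<delta> * real (a $ i0)"
  have q: "q > 0" using a by (simp add: prim_vecs_def q_def)
  have dvd: "q dvd j * a $ i" for i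
  proof (cases "i = i0")
    case False
    then obtain k :: int where k: "\<bar>real j * real (a $ i) / real q - of_int k\<bar> \<le> \<delta>"
      using obs unfolding obstructed_def q_def by blast
    define t where "t = int j * int (a $ i) - int q * k"
    have "\<bar>real_of_int t\<bar> = \<bar>real j * real (a $ i) / real q - of_int k\<bar> * real q"
      unfolding t_def using q by (simp add: abs_mult_pos' algebra_simps)
    also have "\<dots> \<le> \<delta> * real q" using k q by (intro mult_right_mono) auto
    also have "\<dots> < real (gcd j q)" using neg by (simp add: q_def)
    finally have "\<bar>t\<bar> < int (gcd j q)" by linarith
    moreover have "int (gcd j q) dvd t" unfolding t_def by (auto intro!: dvd_diff dvd_mult2)
    ultimately have "t = 0" using zdvd_not_zless[of "\<bar>t\<bar>" "int (gcd j q)"] by (cases "t = 0") auto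
    then have "int q dvd int (j * a $ i)" unfolding t_def by simp
    then show ?thesis by (simp only: int_dvd_int_iff)
  qed (simp add: q_def)
  have "q dvd Gcd ((*) j ` range (\<lambda>i. a $ i))" using dvd by (intro Gcd_greatest) auto
  also have "Gcd ((*) j ` range (\<lambda>i. a $ i)) = j * Gcd (range (\<lambda>i. a $ i))"
    using Gcd_mult[of j "range (\<lambda>i. a $ i)"] by simp
  finally have "q dvd j" using a by (simp add: prim_vecs_def)
  then show False using j by (auto simp: q_def dest: dvd_imp_le)
qed

lemma frobenius_f_bounds:
  obtains C where "C \<ge> 1"
    and "\<And>(a :: nat ^ 'd::finite) i0 H. a \<in> prim_vecs \<Longrightarrow> (\<And>i. a $ i \<le> a $ i0) \<Longrightarrow> H > 0 \<Longrightarrow>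
      (\<And>j. j \<in> {1..<a $ i0} \<Longrightarrow> \<not> obstructed (C / real H) a i0 j) \<Longrightarrow>
      frobenius_f a \<ge> 0 \<and> real_of_int (frobenius_f a) \<le> 2 * real H * (real CARD('d) - 1) * real (a $ i0)"
proof -
  obtain C :: real where C: "C \<ge> 1"
    and cov: "\<And>(I :: 'd set) q H a r. finite I \<Longrightarrow> card I = CARD('d) - 1 \<Longrightarrow> q > 0 \<Longrightarrow> H > 0 \<Longrightarrow>
      (\<And>j. j \<in> {1..<q} \<Longrightarrow> \<exists>i\<in>I. \<forall>k::int. C / real H < \<bar>real j * real (a i) / real q - of_int k\<bar>) \<Longrightarrow>
      \<exists>c. (\<forall>i\<in>I. c i \<le> 2 * (H - 1)) \<and> int q dvd (\<Sum>i\<in>I. int (c i) * int (a i :: nat)) - r"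
    using residues_covered[where ?'i = 'd and n = "CARD('d) - 1"] by blast
  show thesis
  proof (rule that[OF C])
    fix a :: "nat ^ 'd" and i0 H
    assume a: "a \<in> prim_vecs" and max: "\<And>i. a $ i \<le> a $ i0" and H: "H > 0"
      and unobs: "\<And>j. j \<in> {1..<a $ i0} \<Longrightarrow> \<not> obstructed (C / real H) a i0 j"
    define q where "q = a $ i0"
    define s where "s = (\<Sum>i\<in>- {i0}. int (a $ i))"
    have q: "q > 0" using a by (simp add: prim_vecs_def q_def)
    have card: "card (- {i0}) = CARD('d) - 1" by (simp add: Compl_eq_Diff_UNIV card_Diff_singleton)
    have rep: "representable a m" if "m > int (2 * (H - 1)) * s - int q" for m
      using that unfolding s_def q_def
    proof (rule representable_of_residues_covered[rotated 2])
      fix r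
      show "\<exists>c. (\<forall>i\<in>- {i0}. c i \<le> 2 * (H - 1)) \<and>
          int (a $ i0) dvd (\<Sum>i\<in>- {i0}. int (c i) * int (a $ i)) - r"
        using unobs unfolding obstructed_def
        by (intro cov H) (auto simp: card not_le q[unfolded q_def])
    qed (use q in \<open>simp add: q_def\<close>)
    have sum: "(\<Sum>i\<in>UNIV. int (a $ i)) = int q + s"
      unfolding s_def q_def by (subst sum.remove[OF finite UNIV_I[of i0]]) (simp add: Compl_eq_Diff_UNIV)
    have "s \<le> (\<Sum>i\<in>- {i0}. int q)" unfolding s_def q_def using max by (intro sum_mono) auto
    then have s: "0 \<le> s" "s \<le> int (CARD('d) - 1) * int q"
      unfolding card[symmetric] by (auto simp: s_def intro: sum_nonneg)
    have bounds: "-1 \<le> frobenius_number a" "frobenius_number a \<le> int (2 * (H - 1)) * s - int q"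
      by (rule frobenius_number_bounds[OF rep]; assumption)+
    have "frobenius_f a \<ge> 0" unfolding frobenius_f_def sum using bounds(1) s(1) q by simp
    \<comment> \<open>The \<open>- int q\<close> in the bound for the Frobenius number cancels the
      entry \<open>q\<close> in the sum of all entries.\<close>
    have "frobenius_f a \<le> int (2 * (H - 1)) * s + s"
      unfolding frobenius_f_def sum using bounds(2) by simp
    also have "\<dots> \<le> 2 * int H * s" using H s(1) by (simp add: of_nat_diff algebra_simps)
    also have "\<dots> \<le> 2 * int H * (int (CARD('d) - 1) * int q)" using s by (intro mult_left_mono) auto
    finally have "real_of_int (frobenius_f a) \<le> of_int (2 * int H * (int (CARD('d) - 1) * int q))"
      unfolding of_int_le_iff .
    then show "frobenius_f a \<ge> 0 \<and> real_of_int (frobenius_f a) \<le> 2 * real H * (real CARD('d) - 1) * real (a $ i0)"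
      using \<open>frobenius_f a \<ge> 0\<close> by (simp add: q_def of_nat_diff Suc_leI)
  qed
qed

text \<open>The point is that the Frobenius number of a primitive vector exists. With
  \<open>H > C * a $ i0\<close> an obstruction would require a gcd below 1, so there is
  none.\<close>

lemma frobenius_f_nonneg:
  fixes a :: "nat ^ 'd::finite"
  assumes "a \<in> prim_vecs"
  shows "frobenius_f a \<ge> 0"
proof -
  obtain C where C: "C \<ge> 1" and f: "\<And>(a :: nat ^ 'd) i0 H. a \<in> prim_vecs \<Longrightarrow> (\<And>i. a $ i \<le> a $ i0) \<Longrightarrow> H > 0 \<Longrightarrow>
      (\<And>j. j \<in> {1..<a $ i0} \<Longrightarrow> \<not> obstructed (C / real H) a i0 j) \<Longrightarrow> frobenius_f a \<ge> 0"
    by (rule frobenius_f_bounds) blast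
  have "Max (range (($) a)) \<in> range (($) a)" by (intro Max_in) auto
  then obtain i0 where "a $ i0 = Max (range (($) a))" by (metis imageE)
  then have max: "a $ i \<le> a $ i0" for i by simp
  have q: "a $ i0 > 0" using assms by (simp add: prim_vecs_def)
  obtain H :: nat where H: "C * real (a $ i0) < real H" using reals_Archimedean2 by blast
  have "H > 0" using H C q by (metis gr0I mult_nonneg_nonneg not_less of_nat_0 of_nat_0_le_iff order_trans zero_le_one)
  show ?thesis
  proof (rule f[OF assms max \<open>H > 0\<close>])
    fix j assume j: "j \<in> {1..<a $ i0}"
    show "\<not> obstructed (C / real H) a i0 j"
    proof
      assume "obstructed (C / real H) a i0 j"
      then have "real (gcd j (a $ i0)) \<le> C / real H * real (a $ i0)"
        by (rule obstructed_imp_large[OF assms j])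
      also have "\<dots> < 1" using H \<open>H > 0\<close> by (simp add: field_simps)
      finally show False using q by simp
    qed
  qed
qed

section \<open>Counting the entries compatible with an obstruction\<close>

text \<open>Two solutions differ by a multiple of \<open>p = q div gcd j q\<close>, so each of the
  \<open>gcd j q\<close> blocks of length \<open>p\<close> that make up \<open>{1..q}\<close>
  contains at most one.\<close>

lemma card_solutions_mod_le:
  fixes j q :: nat and r :: int
  assumes "q > 0"
  shows "card {x \<in> {1..q}. int q dvd int j * int x - r} \<le> gcd j q"
proof -
  define g where "g = gcd j q"
  define p where "p = q div g"
  define X where "X = {x \<in> {1..q}. int q dvd int j * int x - r}"
  have g: "g > 0" using assms by (simp add: g_def)
  have qgp: "q = g * p" by (simp add: p_def g_def)
  have p: "p > 0" using assms qgp by (cases p) auto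
  have cop: "coprime p (j div g)" unfolding p_def g_def using assms
    by (metis coprime_commute div_gcd_coprime gr_implies_not0)
  have inj: "inj_on (\<lambda>x. (x - 1) div p) X"
  proof (rule linorder_inj_onI')
    fix x y assume xy: "x \<in> X" "y \<in> X" "x < y"
    have "int q dvd (int j * int y - r) - (int j * int x - r)" using xy
      by (intro dvd_diff[of _ "int j * int y - r" "int j * int x - r"]) (simp_all add: X_def)
    also have "\<dots> = int (j * (y - x))" using xy by (simp add: of_nat_diff algebra_simps)
    finally have "q dvd j * (y - x)" by (simp only: int_dvd_int_iff)
    moreover have "j = g * (j div g)" by (simp add: g_def)
    ultimately have "g * p dvd g * ((j div g) * (y - x))" by (metis mult.assoc qgp)
    then have "p dvd (j div g) * (y - x)" using g by simp
    then have "p dvd y - x" using cop by (simp add: coprime_dvd_mult_right_iff)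
    then have "p \<le> y - x" using xy by (auto dest: dvd_imp_le)
    then have "(x - 1) + p \<le> y - 1" using xy by (auto simp: X_def)
    then have "((x - 1) + p) div p \<le> (y - 1) div p" by (rule div_le_mono)
    then show "(x - 1) div p \<noteq> (y - 1) div p" using p by simp
  qed
  have "(\<lambda>x. (x - 1) div p) ` X \<subseteq> {..<g}"
    using p by (auto simp: X_def qgp less_mult_imp_div_less)
  then have "card X \<le> card {..<g}" by (intro card_inj_on_le[OF inj]) auto
  then show ?thesis by (simp add: X_def g_def)
qed

text \<open>With \<open>M = \<delta> * q\<close> and \<open>b = gcd j q\<close>, the offset of
  \<open>j * x\<close> from a multiple of \<open>q\<close> is a multiple of \<open>b\<close> of size
  at most \<open>M\<close>. There are at most \<open>2 * M / b + 1\<close> such offsets, each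
  attained by at most \<open>b\<close> values of \<open>x\<close>, and
  \<open>b <= M\<close>.\<close>

lemma card_near_multiples_le:
  fixes j q :: nat and \<delta> :: real
  assumes q: "q > 0" and g: "real (gcd j q) \<le> \<delta> * real q"
  shows "real (card {x \<in> {1..q}. \<exists>k::int. \<bar>real j * real x / real q - of_int k\<bar> \<le> \<delta>}) \<le> 3 * (\<delta> * real q)"
proof -
  define X where "X = {x \<in> {1..q}. \<exists>k::int. \<bar>real j * real x / real q - of_int k\<bar> \<le> \<delta>}"
  define M where "M = \<delta> * real q"
  define b where "b = gcd j q"
  define N where "N = \<lfloor>M / real b\<rfloor>"
  have b: "b > 0" using q by (simp add: b_def)
  have N: "0 \<le> N" "of_int N \<le> M / real b" using g b by (auto simp: N_def M_def b_def)
  have "X \<subseteq> (\<Union>s\<in>{-N..N}. {x \<in> {1..q}. int q dvd int j * int x - int b * s})"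
  proof
    fix x assume "x \<in> X"
    then obtain k :: int where x: "x \<in> {1..q}" and k: "\<bar>real j * real x / real q - of_int k\<bar> \<le> \<delta>"
      by (auto simp: X_def)
    define t where "t = int j * int x - int q * k"
    have "\<bar>real_of_int t\<bar> = \<bar>real j * real x / real q - of_int k\<bar> * real q"
      unfolding t_def using q by (simp add: abs_mult_pos' algebra_simps)
    also have "\<dots> \<le> M" unfolding M_def using k q by (intro mult_right_mono) auto
    finally have tM: "\<bar>real_of_int t\<bar> \<le> M" .
    have "int b dvd t" unfolding t_def b_def by (auto intro!: dvd_diff dvd_mult2)
    then obtain s where s: "t = int b * s" by blast
    have "\<bar>real_of_int s\<bar> \<le> M / real b" using tM b unfolding s by (simp add: abs_mult field_simps)
    then have "\<bar>s\<bar> \<le> N" unfolding N_def by (simp add: le_floor_iff)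
    moreover have "int j * int x - int b * s = int q * k" using s t_def by simp
    ultimately show "x \<in> (\<Union>s\<in>{-N..N}. {x \<in> {1..q}. int q dvd int j * int x - int b * s})"
      using x by (intro UN_I[of s]) auto
  qed
  then have "card X \<le> card (\<Union>s\<in>{-N..N}. {x \<in> {1..q}. int q dvd int j * int x - int b * s})"
    by (intro card_mono) auto
  also have "\<dots> \<le> (\<Sum>s\<in>{-N..N}. card {x \<in> {1..q}. int q dvd int j * int x - int b * s})"
    by (intro card_UN_le) auto
  also have "\<dots> \<le> (\<Sum>s\<in>{-N..N}. b)"
    unfolding b_def using card_solutions_mod_le[OF q] by (intro sum_mono) auto
  also have "\<dots> = nat (2 * N + 1) * b" using N by (simp add: algebra_simps)
  finally have "real (card X) \<le> real (nat (2 * N + 1) * b)" by (rule of_nat_mono)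
  also have "\<dots> = (2 * of_int N + 1) * real b" using N by simp
  also have "\<dots> \<le> (2 * (M / real b) + 1) * real b" using N by (intro mult_right_mono) auto
  also have "\<dots> = 2 * M + real b" using b by (simp add: field_simps)
  also have "\<dots> \<le> 3 * M" using g by (simp add: M_def b_def)
  finally show ?thesis by (simp add: X_def M_def)
qed

lemma vec_components_in:
  fixes S :: "'d::finite \<Rightarrow> 'b set"
  assumes "\<And>i. finite (S i)"
  shows "finite {a :: 'b ^ 'd. \<forall>i. a $ i \<in> S i}"
    and "card {a :: 'b ^ 'd. \<forall>i. a $ i \<in> S i} = (\<Prod>i\<in>UNIV. card (S i))"
proof -
  have bij: "bij_betw vec_nth {a :: 'b ^ 'd. \<forall>i. a $ i \<in> S i} (PiE UNIV S)"
    by (intro bij_betwI[of _ _ _ vec_lambda]) (auto simp: vec_eq_iff)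
  show "finite {a :: 'b ^ 'd. \<forall>i. a $ i \<in> S i}"
    using bij_betw_finite[OF bij] assms by (simp add: finite_PiE)
  show "card {a :: 'b ^ 'd. \<forall>i. a $ i \<in> S i} = (\<Prod>i\<in>UNIV. card (S i))"
    using bij_betw_same_card[OF bij] by (simp add: card_PiE)
qed

section \<open>Primitive vectors with large Frobenius number\<close>

text \<open>If the gcd is at most \<open>\<delta> * q\<close>, each of the remaining entries has at
  most \<open>3 * (\<delta> * q)\<close> choices. Otherwise \<open>obstructed_imp_large\<close>
  shows that \<open>X\<close> is empty.\<close>

lemma card_obstructed_le:
  fixes i0 :: "'d::finite"
  assumes j: "j \<in> {1..<q}" and \<delta>: "\<delta> \<ge> 0"
  defines "X \<equiv> {a :: nat ^ 'd. a \<in> prim_vecs \<and> a $ i0 = q \<and> (\<forall>i. a $ i \<le> q) \<and> obstructed \<delta> a i0 j}"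
  shows "finite X" "real (card X) \<le> (3 * (\<delta> * real q)) ^ (CARD('d) - 1)"
proof -
  define Z where "Z = {x \<in> {1..q}. \<exists>k::int. \<bar>real j * real x / real q - of_int k\<bar> \<le> \<delta>}"
  define S where "S i = (if i = i0 then {q} else Z)" for i
  define Y where "Y = {a :: nat ^ 'd. \<forall>i. a $ i \<in> S i}"
  have q: "q > 0" using j by auto
  have fin: "finite (S i)" for i by (simp add: S_def Z_def)
  have sub: "X \<subseteq> Y"
    unfolding X_def Y_def S_def Z_def
    by (auto simp: prim_vecs_def obstructed_def Suc_le_eq)
  have "finite Y" unfolding Y_def by (rule vec_components_in(1)[OF fin])
  then show "finite X" using sub by (rule finite_subset[rotated])
  have "card Y = (\<Prod>i\<in>UNIV. card (S i))" unfolding Y_def by (rule vec_components_in(2)[OF fin])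
  also have "\<dots> = card Z ^ (CARD('d) - 1)"
    by (subst prod.remove[OF finite UNIV_I[of i0]]) (simp add: S_def Compl_eq_Diff_UNIV card_Diff_singleton)
  finally have Y: "card Y = card Z ^ (CARD('d) - 1)" .
  show "real (card X) \<le> (3 * (\<delta> * real q)) ^ (CARD('d) - 1)"
  proof (cases "real (gcd j q) \<le> \<delta> * real q")
    case True
    have "real (card X) \<le> real (card Z) ^ (CARD('d) - 1)"
      using card_mono[OF \<open>finite Y\<close> sub] unfolding Y of_nat_power[symmetric] of_nat_le_iff .
    also have "\<dots> \<le> (3 * (\<delta> * real q)) ^ (CARD('d) - 1)"
      unfolding Z_def using card_near_multiples_le[OF q True] by (intro power_mono) auto
    finally show ?thesis .
  next
    case False
    have "X = {}"
    proof (rule ccontr)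
      assume "X \<noteq> {}"
      then obtain a where "a \<in> prim_vecs" "a $ i0 = q" "obstructed \<delta> a i0 j" unfolding X_def by blast
      then show False using obstructed_imp_large[of a j i0 \<delta>] j False by simp
    qed
    then show ?thesis using \<delta> by simp
  qed
qed

text \<open>\<open>H\<close> is chosen as large as the upper bound for \<open>frobenius_f\<close>
  permits, so every vector counted is obstructed by some \<open>j < q\<close>. The union bound over
  \<open>j\<close> costs a factor \<open>q\<close>, which is recovered because the
  \<open>N\<close>th power of \<open>q powr (1 / n)\<close> is \<open>q\<close>.\<close>

lemma card_large_frobenius_f_fixed_max:
  fixes i0 :: "'d::finite"
  assumes card: "CARD('d) \<ge> 2"
  obtains K where "K > 0"
    and "\<And>q R. q > 0 \<Longrightarrow> R > 0 \<Longrightarrow>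
      finite {a :: nat ^ 'd. a \<in> prim_vecs \<and> a $ i0 = q \<and> (\<forall>i. a $ i \<le> q) \<and>
        R * real q powr (real CARD('d) / (real CARD('d) - 1)) < of_int (frobenius_f a)} \<and>
      real (card {a :: nat ^ 'd. a \<in> prim_vecs \<and> a $ i0 = q \<and> (\<forall>i. a $ i \<le> q) \<and>
        R * real q powr (real CARD('d) / (real CARD('d) - 1)) < of_int (frobenius_f a)})
      \<le> K * real q ^ (CARD('d) - 1) / R ^ (CARD('d) - 1)"
proof -
  define N where "N = CARD('d) - 1"
  define n where "n = real CARD('d) - 1"
  have N: "real N = n" "n \<ge> 1" "CARD('d) = Suc N" using card by (auto simp: N_def n_def of_nat_diff)
  obtain C :: real where C: "C \<ge> 1"
    and f_le: "\<And>(a :: nat ^ 'd) i0 H. a \<in> prim_vecs \<Longrightarrow> (\<And>i. a $ i \<le> a $ i0) \<Longrightarrow> H > 0 \<Longrightarrow>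
      (\<And>j. j \<in> {1..<a $ i0} \<Longrightarrow> \<not> obstructed (C / real H) a i0 j) \<Longrightarrow>
      real_of_int (frobenius_f a) \<le> 2 * real H * n * real (a $ i0)"
    unfolding n_def by (rule frobenius_f_bounds) blast
  define K where "K = (12 * C * n) ^ N"
  show thesis
  proof (rule that[of K, folded N_def n_def])
    show "K > 0" using C N unfolding K_def by (intro zero_less_power mult_pos_pos) auto
    fix q :: nat and R :: real
    assume q: "q > 0" and R: "R > 0"
    define A where "A = {a :: nat ^ 'd. a \<in> prim_vecs \<and> a $ i0 = q \<and> (\<forall>i. a $ i \<le> q) \<and>
        R * real q powr (real CARD('d) / n) < of_int (frobenius_f a)}"
    define S where "S i = (if i = i0 then {q} else {1..q})" for i :: 'd
    have fin: "finite (S i)" for i by (simp add: S_def)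
    have sub: "A \<subseteq> {a. \<forall>i. a $ i \<in> S i}"
      unfolding A_def S_def by (auto simp: prim_vecs_def Suc_le_eq)
    have "finite A" using sub vec_components_in(1)[OF fin] by (rule finite_subset)
    \<comment> \<open>Solves \<open>2 * y * n * q = R * q powr (d / n)\<close>, as
      \<open>d / n = 1 + 1 / n\<close>.\<close>
    define y where "y = R * real q powr (1 / n) / (2 * n)"
    have pow: "(real q powr (1 / n)) ^ N = real q"
      using q N by (simp add: powr_realpow[symmetric] powr_powr)
    have "real (card A) \<le> K * real q ^ N / R ^ N"
    \<comment> \<open>For \<open>y < 1\<close> no positive integer \<open>H <= y\<close> exists, but
      then \<open>R\<close> is bounded and the trivial count \<open>q ^ N\<close> is good
      enough.\<close>
    proof (cases "y < 1")
      case True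
      have "card A \<le> card {a. \<forall>i. a $ i \<in> S i}"
        by (rule card_mono[OF vec_components_in(1)[OF fin] sub])
      also have "\<dots> = (\<Prod>i\<in>UNIV. card (S i))" by (rule vec_components_in(2)[OF fin])
      also have "\<dots> = q ^ N"
        by (subst prod.remove[OF finite UNIV_I[of i0]])
          (simp add: S_def Compl_eq_Diff_UNIV card_Diff_singleton N_def)
      finally have "real (card A) \<le> real q ^ N" by (simp only: of_nat_power[symmetric] of_nat_le_iff)
      moreover have "R \<le> 12 * C * n"
      proof -
        have "R * 1 \<le> R * real q powr (1 / n)" using q N R by (intro mult_left_mono ge_one_powr_ge_zero) auto
        also have "\<dots> \<le> 2 * n" using True N by (simp add: y_def field_simps)
        also have "\<dots> \<le> 12 * C * n" using C N by simp
        finally show ?thesis by simp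
      qed
      then have "R ^ N \<le> K" unfolding K_def using R by (intro power_mono) auto
      then have "real q ^ N * R ^ N \<le> real q ^ N * K" by (intro mult_left_mono) auto
      then have "real q ^ N \<le> K * real q ^ N / R ^ N" using R by (simp add: pos_le_divide_eq mult_ac)
      ultimately show ?thesis by linarith
    next
      case False
      define H where "H = nat \<lfloor>y\<rfloor>"
      have H: "real H \<le> y" "real H \<ge> y / 2" "H > 0"
      proof -
        have "1 \<le> \<lfloor>y\<rfloor>" using False by simp
        moreover from this have "real H = of_int \<lfloor>y\<rfloor>" by (simp add: H_def)
        moreover have "of_int \<lfloor>y\<rfloor> \<le> y" "y < of_int \<lfloor>y\<rfloor> + 1" by linarith+
        ultimately show "real H \<le> y" "real H \<ge> y / 2" "H > 0" by linarith+
      qed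
      define B where "B j = {a :: nat ^ 'd. a \<in> prim_vecs \<and> a $ i0 = q \<and> (\<forall>i. a $ i \<le> q) \<and> obstructed (C / real H) a i0 j}" for j
      have "A \<subseteq> (\<Union>j\<in>{1..<q}. B j)"
      proof
        fix a assume a: "a \<in> A"
        show "a \<in> (\<Union>j\<in>{1..<q}. B j)"
        proof (rule ccontr)
          assume *: "a \<notin> (\<Union>j\<in>{1..<q}. B j)"
          have "real_of_int (frobenius_f a) \<le> 2 * real H * n * real (a $ i0)"
            using * a H by (intro f_le) (auto simp: A_def B_def)
          also have "\<dots> \<le> 2 * y * n * real q" using a H N by (auto simp: A_def intro!: mult_right_mono)
          also have "\<dots> = R * (real q powr (1 / n) * real q powr 1)" using N q by (simp add: y_def)
          also have "real q powr (1 / n) * real q powr 1 = real q powr (real CARD('d) / n)"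
            unfolding powr_add[symmetric] using N by (simp add: N(3) add_divide_distrib add_ac)
          finally show False using a by (simp add: A_def)
        qed
      qed
      moreover have fin_B: "finite (B j)" "real (card (B j)) \<le> (3 * (C / real H * real q)) ^ N" if "j \<in> {1..<q}" for j
      proof -
        have "0 \<le> C / real H" using C by simp
        then show "finite (B j)" "real (card (B j)) \<le> (3 * (C / real H * real q)) ^ N"
          unfolding B_def N_def by (rule card_obstructed_le[OF that])+
      qed
      ultimately have "card A \<le> card (\<Union>j\<in>{1..<q}. B j)" by (intro card_mono) auto
      also have "\<dots> \<le> (\<Sum>j\<in>{1..<q}. card (B j))" by (intro card_UN_le) auto
      finally have "real (card A) \<le> (\<Sum>j\<in>{1..<q}. real (card (B j)))" by (metis of_nat_le_iff of_nat_sum)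
      also have "\<dots> \<le> (\<Sum>j\<in>{1..<q}. (3 * (C / real H * real q)) ^ N)" using fin_B by (intro sum_mono) auto
      also have "\<dots> \<le> real q * (3 * (C / real H * real q)) ^ N" using C by (auto intro!: mult_right_mono)
      \<comment> \<open>Rounding \<open>y\<close> down to \<open>H\<close> loses at most a factor 2;
        with the factors 3 and \<open>2 * n\<close> this gives the 12 in \<open>K\<close>.\<close>
      also have "\<dots> \<le> real q * (3 * (C / (y / 2) * real q)) ^ N"
        using C H False by (intro mult_left_mono power_mono mult_right_mono divide_left_mono) auto
      also have "3 * (C / (y / 2) * real q) = 12 * C * n * real q / (R * real q powr (1 / n))"
        unfolding y_def by simp
      also have "real q * (12 * C * n * real q / (R * real q powr (1 / n))) ^ N = K * real q ^ N / R ^ N"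
        unfolding power_divide power_mult_distrib[of R] pow K_def power_mult_distrib[of _ "real q"]
        using q by simp
      finally show ?thesis .
    qed
    with \<open>finite A\<close> show "finite {a :: nat ^ 'd. a \<in> prim_vecs \<and> a $ i0 = q \<and> (\<forall>i. a $ i \<le> q) \<and>
        R * real q powr (real CARD('d) / n) < of_int (frobenius_f a)} \<and>
      real (card {a :: nat ^ 'd. a \<in> prim_vecs \<and> a $ i0 = q \<and> (\<forall>i. a $ i \<le> q) \<and>
        R * real q powr (real CARD('d) / n) < of_int (frobenius_f a)}) \<le> K * real q ^ N / R ^ N"
      unfolding A_def by blast
  qed
qed

definition max_entry :: "nat ^ 'd::finite \<Rightarrow> nat" where
  "max_entry a = Max (range (($) a))"

lemma max_entry_ge: "a $ i \<le> max_entry a"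
  by (simp add: max_entry_def)

lemma max_entry_eq:
  obtains i where "a $ i = max_entry a"
proof -
  have "Max (range (($) a)) \<in> range (($) a)" by (intro Max_in) auto
  then show thesis using that unfolding max_entry_def by (metis imageE)
qed

text \<open>Union bound over the position and the value of the largest entry; the at most
  \<open>Y\<close> values supply the extra factor \<open>Y\<close>.\<close>

proposition card_large_frobenius_f:
  assumes card: "CARD('d::finite) \<ge> 2"
  obtains K where "K > 0"
    and "\<And>Y R. R > 0 \<Longrightarrow>
      finite {a :: nat ^ 'd. a \<in> prim_vecs \<and> (\<forall>i. a $ i \<le> Y) \<and>
        R * real (max_entry a) powr (real CARD('d) / (real CARD('d) - 1)) < of_int (frobenius_f a)} \<and>
      real (card {a :: nat ^ 'd. a \<in> prim_vecs \<and> (\<forall>i. a $ i \<le> Y) \<and>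
        R * real (max_entry a) powr (real CARD('d) / (real CARD('d) - 1)) < of_int (frobenius_f a)})
      \<le> K * real Y ^ CARD('d) / R ^ (CARD('d) - 1)"
proof -
  define A where "A i0 q R = {a :: nat ^ 'd. a \<in> prim_vecs \<and> a $ i0 = q \<and> (\<forall>i. a $ i \<le> q) \<and>
        R * real q powr (real CARD('d) / (real CARD('d) - 1)) < of_int (frobenius_f a)}" for i0 q R
  have "\<forall>i0. \<exists>K. K > 0 \<and> (\<forall>q R. q > 0 \<longrightarrow> R > 0 \<longrightarrow>
      finite (A i0 q R) \<and> real (card (A i0 q R)) \<le> K * real q ^ (CARD('d) - 1) / R ^ (CARD('d) - 1))"
    unfolding A_def by (intro allI, rule card_large_frobenius_f_fixed_max[OF card]) blast
  then obtain K where K: "\<And>i0. K i0 > 0" and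
    A: "\<And>i0 q R. q > 0 \<Longrightarrow> R > 0 \<Longrightarrow> finite (A i0 q R)"
       "\<And>i0 q R. q > 0 \<Longrightarrow> R > 0 \<Longrightarrow> real (card (A i0 q R)) \<le> K i0 * real q ^ (CARD('d) - 1) / R ^ (CARD('d) - 1)"
    by metis
  show thesis
  proof (rule that[of "\<Sum>i\<in>UNIV. K i"])
    show "(\<Sum>i\<in>UNIV. K i) > 0" using K by (intro sum_pos) auto
    fix Y :: nat and R :: real assume R: "R > 0"
    define B where "B = {a :: nat ^ 'd. a \<in> prim_vecs \<and> (\<forall>i. a $ i \<le> Y) \<and>
        R * real (max_entry a) powr (real CARD('d) / (real CARD('d) - 1)) < of_int (frobenius_f a)}"
    have sub: "B \<subseteq> (\<Union>i0\<in>UNIV. \<Union>q\<in>{1..Y}. A i0 q R)"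
    proof
      fix a assume a: "a \<in> B"
      obtain i0 where i0: "a $ i0 = max_entry a" by (rule max_entry_eq)
      have "a $ i0 > 0" "a $ i0 \<le> Y" using a by (simp_all add: B_def prim_vecs_def)
      then show "a \<in> (\<Union>i0\<in>UNIV. \<Union>q\<in>{1..Y}. A i0 q R)"
        using a i0 max_entry_ge[of a]
        by (intro UN_I[of i0] UN_I[of "max_entry a"]) (auto simp: A_def B_def Suc_le_eq)
    qed
    have fin: "finite (\<Union>i0\<in>UNIV. \<Union>q\<in>{1..Y}. A i0 q R)" using A(1) R by auto
    have "card B \<le> card (\<Union>i0\<in>UNIV. \<Union>q\<in>{1..Y}. A i0 q R)" by (rule card_mono[OF fin sub])
    also have "\<dots> \<le> (\<Sum>i0\<in>UNIV. \<Sum>q\<in>{1..Y}. card (A i0 q R))"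
      by (rule order_trans[OF card_UN_le sum_mono[OF card_UN_le]]) auto
    finally have "real (card B) \<le> (\<Sum>i0\<in>UNIV. \<Sum>q\<in>{1..Y}. real (card (A i0 q R)))"
      by (simp only: of_nat_sum[symmetric] of_nat_le_iff)
    also have "\<dots> \<le> (\<Sum>i0\<in>UNIV. \<Sum>q\<in>{1..Y}. K i0 * real Y ^ (CARD('d) - 1) / R ^ (CARD('d) - 1))"
    proof (intro sum_mono)
      fix i0 q assume q: "q \<in> {1..Y}"
      have "real (card (A i0 q R)) \<le> K i0 * real q ^ (CARD('d) - 1) / R ^ (CARD('d) - 1)" using A(2) q R by auto
      also have "\<dots> \<le> K i0 * real Y ^ (CARD('d) - 1) / R ^ (CARD('d) - 1)"
        using q R K[of i0] by (intro divide_right_mono mult_left_mono power_mono) auto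
      finally show "real (card (A i0 q R)) \<le> K i0 * real Y ^ (CARD('d) - 1) / R ^ (CARD('d) - 1)" .
    qed
    also have "\<dots> = (\<Sum>i\<in>UNIV. K i) * (real Y * real Y ^ (CARD('d) - 1)) / R ^ (CARD('d) - 1)"
      by (simp add: sum_distrib_right sum_divide_distrib sum_distrib_left mult_ac)
    also have "real Y * real Y ^ (CARD('d) - 1) = real Y ^ CARD('d)"
      by (simp add: power_Suc[symmetric])
    finally show "finite {a :: nat ^ 'd. a \<in> prim_vecs \<and> (\<forall>i. a $ i \<le> Y) \<and>
        R * real (max_entry a) powr (real CARD('d) / (real CARD('d) - 1)) < of_int (frobenius_f a)} \<and>
      real (card {a :: nat ^ 'd. a \<in> prim_vecs \<and> (\<forall>i. a $ i \<le> Y) \<and>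
        R * real (max_entry a) powr (real CARD('d) / (real CARD('d) - 1)) < of_int (frobenius_f a)})
      \<le> (\<Sum>i\<in>UNIV. K i) * real Y ^ CARD('d) / R ^ (CARD('d) - 1)"
      using finite_subset[OF sub fin] unfolding B_def by blast
  qed
qed

section \<open>Density of primitive vectors\<close>

text \<open>Multiples of \<open>g\<close> are at least \<open>g\<close> apart, so each block of
  length \<open>g\<close> holds at most one. The trivial bound \<open>m\<close> serves all but three
  coordinates in the sieve below.\<close>

lemma card_multiples_interval_le:
  fixes g m u :: nat
  assumes "g > 0"
  defines "X \<equiv> {x \<in> {u + 1..u + m}. g dvd x}"
  shows "card X \<le> m" "real (card X) \<le> real m / real g + 1"
proof -
  have "card X \<le> card {u + 1..u + m}" unfolding X_def by (intro card_mono) auto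
  then show "card X \<le> m" by simp
  have inj: "inj_on (\<lambda>x. (x - (u + 1)) div g) X"
  proof (rule linorder_inj_onI')
    fix x y assume xy: "x \<in> X" "y \<in> X" "x < y"
    have "g dvd y - x" using xy by (intro dvd_diff_nat) (auto simp: X_def)
    then have "g \<le> y - x" using xy by (auto dest: dvd_imp_le)
    then have "(x - (u + 1)) + g \<le> y - (u + 1)" using xy by (auto simp: X_def)
    then have "((x - (u + 1)) + g) div g \<le> (y - (u + 1)) div g" by (rule div_le_mono)
    then show "(x - (u + 1)) div g \<noteq> (y - (u + 1)) div g" using assms by simp
  qed
  have "(\<lambda>x. (x - (u + 1)) div g) ` X \<subseteq> {..m div g}"
    by (auto simp: X_def intro!: div_le_mono)
  then have "card X \<le> card {..m div g}" by (intro card_inj_on_le[OF inj]) auto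
  then have "real (card X) \<le> real (m div g) + 1" by simp
  also have "real (m div g) \<le> real m / real g" by (rule of_nat_div_le_of_nat)
  finally show "real (card X) \<le> real m / real g + 1" by simp
qed

text \<open>For \<open>g >= 2\<close> the leading term satisfies 1 / g ^ 3 <= 1 / (2 * g ^ 2), and
  the inverse squares from 2 on sum to at most 1. This gives the coefficient 1 / 2; the rest is of
  order \<open>m ^ 2\<close>.\<close>

lemma sum_cubes_le:
  fixes m K :: nat
  assumes "m > 0"
  shows "(\<Sum>g\<in>{2..K * m}. (real m / real g + 1) ^ 3) \<le> real m ^ 3 / 2 + (3 + 3 * real K) * real m ^ 2"
proof -
  have "(real m / real g + 1) ^ 3 \<le> (real m ^ 3 / 2 + 3 * real m ^ 2) * (1 / real g ^ 2) + 3 * real m"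
    if "g \<in> {2..K * m}" for g
  proof -
    have g: "real g \<ge> 2" using that by auto
    have m: "real m \<ge> 1" using assms by simp
    define r where "r = 1 / real g"
    have r: "0 \<le> r" "r \<le> 1 / 2" using g unfolding r_def by (auto intro!: divide_left_mono)
    have "(real m * r + 1) ^ 3 = real m ^ 3 * r ^ 2 * r + 3 * real m ^ 2 * r ^ 2 + 3 * real m * r + 1"
      by (simp add: algebra_simps power2_eq_square power3_eq_cube)
    moreover have "real m ^ 3 * r ^ 2 * r \<le> real m ^ 3 * r ^ 2 * (1 / 2)" using r by (intro mult_left_mono) auto
    moreover have "3 * real m * r \<le> 3 * real m * (1 / 2)" using r by (intro mult_left_mono) auto
    moreover have "(real m ^ 3 / 2 + 3 * real m ^ 2) * r ^ 2 = real m ^ 3 * r ^ 2 * (1 / 2) + 3 * real m ^ 2 * r ^ 2"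
      by (simp add: algebra_simps)
    ultimately have "(real m * r + 1) ^ 3 \<le> (real m ^ 3 / 2 + 3 * real m ^ 2) * r ^ 2 + 3 * real m"
      using m by linarith
    then show ?thesis by (simp add: r_def power_divide)
  qed
  then have "(\<Sum>g\<in>{2..K * m}. (real m / real g + 1) ^ 3) \<le>
      (\<Sum>g\<in>{2..K * m}. (real m ^ 3 / 2 + 3 * real m ^ 2) * (1 / real g ^ 2) + 3 * real m)"
    by (rule sum_mono)
  also have "\<dots> = (real m ^ 3 / 2 + 3 * real m ^ 2) * (\<Sum>g\<in>{2..K * m}. 1 / real g ^ 2) + real (K * m - 1) * (3 * real m)"
    by (simp add: sum.distrib sum_distrib_left)
  also have "\<dots> \<le> (real m ^ 3 / 2 + 3 * real m ^ 2) * 1 + real (K * m) * (3 * real m)"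
  proof (intro add_mono mult_left_mono mult_right_mono)
    have "(\<Sum>g\<in>{1..K * m}. 1 / real g ^ 2) = (\<Sum>w<K * m. 1 / (real w + 1) ^ 2)"
      by (rule sum.reindex_bij_witness[of _ Suc "\<lambda>g. g - 1"]) (auto simp: add_ac)
    also have "\<dots> \<le> 2" using sum_inverse_squares_le[of "K * m"] by (rule order_trans) simp
    finally have "(\<Sum>g\<in>{1..K * m}. 1 / real g ^ 2) \<le> 2" .
    moreover have "{1..K * m} = insert 1 {2..K * m}" if "K * m \<noteq> 0" using that by auto
    ultimately show "(\<Sum>g\<in>{2..K * m}. 1 / real g ^ 2) \<le> 1" by (cases "K * m = 0") auto
    show "real (K * m - 1) \<le> real (K * m)" by (rule of_nat_mono) simp
  qed auto
  finally show ?thesis by (simp add: algebra_simps power2_eq_square)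
qed

text \<open>A crude sieve: a non-primitive vector of the box is divisible by some \<open>g\<close>
  in \<open>{2..K * m}\<close>. Three coordinates already give decay 1 / g ^ 3, so the union bound
  removes at most half of the box up to lower order, and at most three quarters for large
  \<open>m\<close>.\<close>

proposition card_prim_vecs_box_ge:
  fixes u :: "'d::finite \<Rightarrow> nat" and m K :: nat
  assumes d: "CARD('d) \<ge> 3" and K: "\<And>i. u i + m \<le> K * m" and m: "24 * K \<le> m" "m > 0"
  defines "B \<equiv> {a :: nat ^ 'd. \<forall>i. a $ i \<in> {u i + 1..u i + m}}"
  shows "finite B" "real m ^ CARD('d) / 4 \<le> real (card (B \<inter> prim_vecs))"
proof -
  define P where "P g = {a :: nat ^ 'd. \<forall>i. a $ i \<in> {x \<in> {u i + 1..u i + m}. g dvd x}}" for g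
  have K1: "K \<ge> 1" using K[of undefined] m by (cases K) auto
  obtain D where D: "CARD('d) = D + 3" using d by (metis add.commute le_Suc_ex)
  show fin: "finite B" unfolding B_def by (rule vec_components_in(1)) simp
  have card_B: "card B = m ^ CARD('d)" unfolding B_def by (subst vec_components_in(2)) auto
  have P_fin: "finite (P g)" for g unfolding P_def by (rule vec_components_in(1)) simp
  have sub: "B - prim_vecs \<subseteq> (\<Union>g\<in>{2..K * m}. P g)"
  proof
    fix a assume a: "a \<in> B - prim_vecs"
    define g where "g = Gcd (range (\<lambda>i. a $ i))"
    have "u i + 1 \<le> a $ i" for i using a by (auto simp: B_def Suc_le_eq)
    then have "\<forall>i. 0 < a $ i" by (metis add_is_0 gr0I le_zero_eq one_neq_zero)
    then have "g \<noteq> 1" using a by (auto simp: g_def prim_vecs_def)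
    have dvd: "g dvd a $ i" for i by (auto simp: g_def)
    then have "g \<noteq> 0" using \<open>\<forall>i. 0 < a $ i\<close> by (metis dvd_0_left less_irrefl)
    have "g \<le> a $ undefined" using dvd \<open>\<forall>i. 0 < a $ i\<close> by (intro dvd_imp_le) auto
    also have "\<dots> \<le> u undefined + m" using a by (auto simp: B_def)
    also have "\<dots> \<le> K * m" by (rule K)
    finally show "a \<in> (\<Union>g\<in>{2..K * m}. P g)"
      using a dvd \<open>g \<noteq> 1\<close> \<open>g \<noteq> 0\<close> by (intro UN_I[of g]) (auto simp: P_def B_def)
  qed
  have P_card: "real (card (P g)) \<le> real m ^ D * (real m / real g + 1) ^ 3" if "g > 0" for g
  proof -
    define c where "c i = card {x \<in> {u i + 1..u i + m}. g dvd x}" for i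
    have c: "real (c i) \<le> min (real m) (real m / real g + 1)" for i
      using card_multiples_interval_le[OF that, where u = "u i" and m = m] by (simp add: c_def)
    have "card (P g) = (\<Prod>i\<in>UNIV. c i)" unfolding P_def c_def by (rule vec_components_in(2)) simp
    then have "real (card (P g)) = (\<Prod>i\<in>UNIV. real (c i))" by simp
    also have "\<dots> \<le> (\<Prod>i\<in>(UNIV :: 'd set). min (real m) (real m / real g + 1))"
      by (intro prod_mono conjI c) simp
    also have "\<dots> = min (real m) (real m / real g + 1) ^ D * min (real m) (real m / real g + 1) ^ 3"
      by (simp add: D power_add)
    also have "\<dots> \<le> real m ^ D * (real m / real g + 1) ^ 3" by (intro mult_mono power_mono) auto
    finally show ?thesis .
  qed
  have "card (B - prim_vecs) \<le> card (\<Union>g\<in>{2..K * m}. P g)" using P_fin by (intro card_mono[OF _ sub]) auto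
  also have "\<dots> \<le> (\<Sum>g\<in>{2..K * m}. card (P g))" by (intro card_UN_le) auto
  finally have "real (card (B - prim_vecs)) \<le> (\<Sum>g\<in>{2..K * m}. real (card (P g)))"
    by (simp only: of_nat_sum[symmetric] of_nat_le_iff)
  also have "\<dots> \<le> (\<Sum>g\<in>{2..K * m}. real m ^ D * (real m / real g + 1) ^ 3)"
    by (intro sum_mono P_card) auto
  also have "\<dots> \<le> real m ^ D * (real m ^ 3 / 2 + (3 + 3 * real K) * real m ^ 2)"
    unfolding sum_distrib_left[symmetric] by (intro mult_left_mono sum_cubes_le m) auto
  also have "\<dots> \<le> real m ^ D * (3 / 4 * real m ^ 3)"
  proof (intro mult_left_mono)
    \<comment> \<open>As \<open>K >= 1\<close>, the factor \<open>3 + 3 * K\<close> is at most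
      \<open>6 * K\<close>, and \<open>24 * K <= m\<close> bounds this by
      \<open>m / 4\<close>.\<close>
    have "(3 + 3 * real K) * real m ^ 2 \<le> (real m / 4) * real m ^ 2"
      using m K1 by (intro mult_right_mono) auto
    then show "real m ^ 3 / 2 + (3 + 3 * real K) * real m ^ 2 \<le> 3 / 4 * real m ^ 3"
      by (simp add: power3_eq_cube power2_eq_square)
  qed auto
  also have "\<dots> = 3 / 4 * real m ^ CARD('d)" by (simp add: D power_add)
  finally have "real (card (B - prim_vecs)) \<le> 3 / 4 * real m ^ CARD('d)" .
  moreover have "real (card B) = real (card (B \<inter> prim_vecs)) + real (card (B - prim_vecs))"
    using card_Int_Diff[OF fin] by (metis of_nat_add)
  ultimately show "real m ^ CARD('d) / 4 \<le> real (card (B \<inter> prim_vecs))" by (simp add: card_B)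
qed

section \<open>Primitive vectors in dilates of \<open>D\<close>\<close>

lemma prim_vecs_in_bounded:
  fixes D :: "(real ^ 'd::finite) set"
  assumes "bounded D"
  obtains K where "K > 0" and "\<And>T a i. a \<in> prim_vecs_in (scaleR T ` D) \<Longrightarrow> real (a $ i) \<le> K * \<bar>T\<bar>"
    and "\<And>T. finite (prim_vecs_in (scaleR T ` D))"
proof -
  obtain K where K: "K > 0" "\<And>x. x \<in> D \<Longrightarrow> norm x \<le> K" using assms bounded_pos by blast
  have le: "real (a $ i) \<le> K * \<bar>T\<bar>" if "a \<in> prim_vecs_in (scaleR T ` D)" for T a i
  proof -
    have "(\<chi> i. real (a $ i)) \<in> scaleR T ` D" using that by (simp add: prim_vecs_in_def)
    then obtain x where x: "(\<chi> i. real (a $ i)) = T *\<^sub>R x" "x \<in> D" by (rule imageE)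
    have "real (a $ i) = T * x $ i" using x(1) by (simp add: vec_eq_iff)
    also have "\<dots> \<le> \<bar>T\<bar> * norm x" using component_le_norm_cart[of x i]
      by (metis abs_ge_self abs_mult abs_ge_zero mult_left_mono order_trans)
    also have "\<dots> \<le> \<bar>T\<bar> * K" using K(2)[OF x(2)] by (intro mult_left_mono) auto
    finally show ?thesis by (simp add: mult_ac)
  qed
  have "finite (prim_vecs_in (scaleR T ` D))" for T
  proof (rule finite_subset)
    show "prim_vecs_in (scaleR T ` D) \<subseteq> {a. \<forall>i. a $ i \<in> {..nat \<lfloor>K * \<bar>T\<bar>\<rfloor>}}"
      using le by (auto simp: le_nat_floor)
  qed (rule vec_components_in(1), simp)
  with K(1) le show thesis by (rule that)
qed

text \<open>Supplies the lower bound for the denominators of the averages. An interior cube, dilated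
  by \<open>T\<close>, contains an integer box of side about \<open>\<epsilon> * T\<close>, to which
  the sieve applies.\<close>

proposition card_prim_vecs_in_ge:
  fixes D :: "(real ^ 'd::finite) set"
  assumes d: "CARD('d) \<ge> 3" and nonneg: "D \<subseteq> {x. \<forall>i. 0 \<le> x $ i}" and "bounded D" and int: "interior D \<noteq> {}"
  obtains c where "c > 0"
    and "\<forall>\<^sub>F T in at_top. c * T ^ CARD('d) \<le> real (card (prim_vecs_in (scaleR T ` D)))"
proof -
  obtain x where x: "x \<in> interior D" using int by blast
  then obtain e where e: "e > 0" "ball x e \<subseteq> D" using mem_interior by blast
  define \<epsilon> where "\<epsilon> = e / (2 * real CARD('d))"
  have \<epsilon>: "\<epsilon> > 0" using e d by (simp add: \<epsilon>_def)
  have x_nonneg: "0 \<le> x $ i" for i using x nonneg interior_subset by blast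
  have cube: "y \<in> D" if "\<And>i. \<bar>y $ i - x $ i\<bar> \<le> \<epsilon>" for y
  proof -
    have "norm (y - x) \<le> (\<Sum>i\<in>UNIV. \<bar>(y - x) $ i\<bar>)" by (rule norm_le_l1_cart)
    also have "\<dots> \<le> (\<Sum>i\<in>(UNIV :: 'd set). \<epsilon>)" using that by (intro sum_mono) simp
    also have "\<dots> < e" using e d by (simp add: \<epsilon>_def)
    finally show ?thesis using e by (auto simp: dist_norm norm_minus_commute)
  qed
  \<comment> \<open>Bounds the ratio between the coordinates of the box and its side, uniformly in
    \<open>T\<close>.\<close>
  define K where "K = nat \<lceil>2 * (norm x + \<epsilon>) / \<epsilon>\<rceil>"
  have K: "real K \<ge> 2 * (norm x + \<epsilon>) / \<epsilon>" unfolding K_def by linarith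
  obtain K' where fin: "\<And>T. finite (prim_vecs_in (scaleR T ` D))"
    using prim_vecs_in_bounded[OF \<open>bounded D\<close>] by blast
  have large: "(\<epsilon> / 2) ^ CARD('d) / 4 * T ^ CARD('d) \<le> real (card (prim_vecs_in (scaleR T ` D)))"
    if T: "T > 0" "T \<ge> (48 * real K + 2) / \<epsilon>" for T
  proof -
    define m where "m = nat \<lfloor>\<epsilon> * T\<rfloor>"
    define u where "u i = nat \<lfloor>T * x $ i\<rfloor>" for i
    \<comment> \<open>The summand 2 ensures that the floor in \<open>m\<close> loses at most half,
      and half of \<open>48 * K\<close> is the \<open>24 * K\<close> that the sieve
      requires.\<close>
    have \<epsilon>T: "\<epsilon> * T \<ge> 48 * real K + 2" using T \<epsilon> by (simp add: field_simps)
    have "real m = of_int \<lfloor>\<epsilon> * T\<rfloor>" using \<epsilon> T by (simp add: m_def)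
    then have m: "real m \<le> \<epsilon> * T" "\<epsilon> * T < real m + 1" by linarith+
    have u: "real (u i) \<le> T * x $ i" "T * x $ i < real (u i) + 1" for i
    proof -
      have "real (u i) = of_int \<lfloor>T * x $ i\<rfloor>" using x_nonneg[of i] T by (simp add: u_def)
      then show "real (u i) \<le> T * x $ i" "T * x $ i < real (u i) + 1" by linarith+
    qed
    have m2: "real m \<ge> \<epsilon> * T / 2" using m \<epsilon>T by linarith
    define B where "B = {a :: nat ^ 'd. \<forall>i. a $ i \<in> {u i + 1..u i + m}}"
    have um: "u i + m \<le> K * m" for i
    proof -
      have "x $ i \<le> norm x" using component_le_norm_cart[of x i] by linarith
      then have "real (u i) \<le> T * norm x" using u(1)[of i] T by (meson mult_left_mono less_imp_le order_trans)
      then have "real (u i) + real m \<le> T * norm x + \<epsilon> * T" using m by linarith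
      also have "\<dots> = 2 * (norm x + \<epsilon>) / \<epsilon> * (\<epsilon> * T / 2)" using \<epsilon> by (simp add: field_simps)
      also have "\<dots> \<le> real K * real m" using K m2 \<epsilon> T by (intro mult_mono) auto
      finally show ?thesis by (simp only: of_nat_add[symmetric] of_nat_mult[symmetric] of_nat_le_iff)
    qed
    have m24: "24 * K \<le> m" "m > 0" using m2 \<epsilon>T by linarith+
    have "B \<inter> prim_vecs \<subseteq> prim_vecs_in (scaleR T ` D)"
    proof
      fix a assume a: "a \<in> B \<inter> prim_vecs"
      define y where "y = (1 / T) *\<^sub>R (\<chi> i. real (a $ i))"
      have "y \<in> D"
      proof (rule cube)
        fix i
        have "u i + 1 \<le> a $ i" "a $ i \<le> u i + m" using a by (auto simp: B_def Suc_le_eq)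
        then have "real (a $ i) \<ge> real (u i) + 1" "real (a $ i) \<le> real (u i) + real m" by linarith+
        then have "0 \<le> real (a $ i) - T * x $ i" "real (a $ i) - T * x $ i \<le> \<epsilon> * T"
          using u[of i] m by linarith+
        moreover have "y $ i - x $ i = (real (a $ i) - T * x $ i) / T" using T by (simp add: y_def field_simps)
        ultimately have "0 \<le> y $ i - x $ i" "y $ i - x $ i \<le> \<epsilon>" using T by (simp_all add: pos_divide_le_eq)
        then show "\<bar>y $ i - x $ i\<bar> \<le> \<epsilon>" by linarith
      qed
      moreover have "(\<chi> i. real (a $ i)) = T *\<^sub>R y" using T by (simp add: y_def)
      ultimately show "a \<in> prim_vecs_in (scaleR T ` D)" using a by (auto simp: prim_vecs_in_def)
    qed
    then have "card (B \<inter> prim_vecs) \<le> card (prim_vecs_in (scaleR T ` D))" using fin by (intro card_mono)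
    then have "real m ^ CARD('d) / 4 \<le> real (card (prim_vecs_in (scaleR T ` D)))"
      using card_prim_vecs_box_ge(2)[OF d, of u, OF um m24] unfolding B_def by linarith
    moreover have "(\<epsilon> * T / 2) ^ CARD('d) \<le> real m ^ CARD('d)" using m2 \<epsilon> T by (intro power_mono) auto
    ultimately show ?thesis by (simp add: power_mult_distrib power_divide)
  qed
  have "\<forall>\<^sub>F T in at_top. (\<epsilon> / 2) ^ CARD('d) / 4 * T ^ CARD('d) \<le> real (card (prim_vecs_in (scaleR T ` D)))"
    using eventually_gt_at_top[of 0] eventually_ge_at_top[of "(48 * real K + 2) / \<epsilon>"]
    by eventually_elim (rule large)
  moreover have "(\<epsilon> / 2) ^ CARD('d) / 4 > 0" using \<epsilon> by simp
  ultimately show thesis using that by blast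
qed

section \<open>Convergence of moments\<close>

text \<open>The layer-cake form of \<open>x ^ k\<close>. The interval is half-open so that its
  indicator expresses the strict inequality \<open>R < x\<close> of the limit law.\<close>

lemma integral_power_tail:
  fixes x :: real and k :: nat
  assumes "0 \<le> x" "1 \<le> k"
  shows "integrable lborel (\<lambda>R. indicator {0..<x} R * (real k * R ^ (k - 1)))"
    and "(\<integral>R. indicator {0..<x} R * (real k * R ^ (k - 1)) \<partial>lborel) = x ^ k"
proof -
  have ae: "AE R in lborel. (indicator {0..<x} R * (real k * R ^ (k - 1)) :: real) = real k * (R ^ (k - 1) * indicator {0..x} R)"
  proof (rule AE_I')
    show "{x} \<in> null_sets lborel" by (simp add: finite_imp_null_set_lborel)
  qed (auto simp: indicator_def)
  have "integrable lborel (\<lambda>R. R ^ (k - 1) * indicator {0..x} R)"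
    using borel_integrable_atLeastAtMost'[of 0 x "\<lambda>R. R ^ (k - 1)"]
    by (simp add: set_integrable_def mult.commute continuous_intros)
  then have "integrable lborel (\<lambda>R. real k * (R ^ (k - 1) * indicator {0..x} R))" by simp
  then show "integrable lborel (\<lambda>R. indicator {0..<x} R * (real k * R ^ (k - 1)))"
    using ae by (subst integrable_cong_AE[OF _ _ ae]) auto
  have "(\<integral>R. indicator {0..<x} R * (real k * R ^ (k - 1)) \<partial>lborel) = (\<integral>R. real k * (R ^ (k - 1) * indicator {0..x} R) \<partial>lborel)"
    by (intro integral_cong_AE ae) auto
  also have "\<dots> = x ^ k" using integral_power[OF assms(1), of "k - 1"] assms(2) by simp
  finally show "(\<integral>R. indicator {0..<x} R * (real k * R ^ (k - 1)) \<partial>lborel) = x ^ k" .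
qed

lemma integrable_powr_tail:
  fixes e :: real
  assumes "e < -1"
  shows "integrable lborel (\<lambda>R. indicator {1..} R * R powr e)"
proof -
  have "(\<lambda>x. x powr e) integrable_on {1..}"
    using has_integral_powr_to_inf[OF assms, of 1] by auto
  then have "integrable lebesgue (\<lambda>R. indicator {1..} R *\<^sub>R R powr e)"
    by (intro nonnegative_absolutely_integrable_1 [unfolded set_integrable_def]) auto
  then show ?thesis by (subst (asm) integrable_completion) auto
qed

text \<open>The average of \<open>X a ^ k\<close> is the integral of \<open>k * R ^ (k - 1)\<close>
  times the proportion of \<open>a\<close> with \<open>X a > R\<close>. The integrand converges
  pointwise by \<open>lim\<close>, and \<open>tail\<close> provides an integrable majorant.\<close>

proposition moments_converge:
  fixes A :: "real \<Rightarrow> 'a set" and X :: "'a \<Rightarrow> real" and \<Psi> :: "real \<Rightarrow> real"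
  assumes k: "1 \<le> k"
    and fin: "\<And>T. finite (A T)"
    and nonneg: "\<And>T a. a \<in> A T \<Longrightarrow> 0 \<le> X a"
    and cont: "continuous_on {0..} \<Psi>"
    and lim: "\<And>R. 0 \<le> R \<Longrightarrow>
      ((\<lambda>T. real (card {a \<in> A T. X a > R}) / real (card (A T))) \<longlongrightarrow> \<Psi> R) at_top"
    and tail: "\<forall>\<^sub>F T in at_top. \<forall>R\<ge>1.
      real (card {a \<in> A T. X a > R}) / real (card (A T)) \<le> B * R powr - (real k + 1 / 4)"
  shows "((\<lambda>T. 1 / real (card (A T)) * (\<Sum>a\<in>A T. X a ^ k)) \<longlongrightarrow> limit_moment \<Psi> k) at_top"
proof -
  define s where "s T R = 1 / real (card (A T)) *
    (\<Sum>a\<in>A T. indicator {0..<X a} R * (real k * R ^ (k - 1)))" for T R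
  define f where "f R = indicator {0..} R * (real k * R ^ (k - 1) * \<Psi> R)" for R
  \<comment> \<open>Below 1 a proportion is at most 1; from 1 on the exponents \<open>k - 1\<close>
    and \<open>- (k + 1 / 4)\<close> add up to -5 / 4.\<close>
  define w where "w R = indicator {0..<1} R * (real k * R ^ (k - 1)) +
    real k * B * (indicator {1..} R * R powr (-5 / 4))" for R
  have s_eq: "s T R = indicator {0..} R * (real k * R ^ (k - 1) * (real (card {a \<in> A T. X a > R}) / real (card (A T))))" for T R
  proof -
    have "(\<Sum>a\<in>A T. indicator {0..<X a} R) = (\<Sum>a\<in>A T. indicator {0..} R * (if X a > R then 1 else 0 :: real))"
      by (intro sum.cong refl) (auto simp: indicator_def)
    also have "\<dots> = indicator {0..} R * real (card {a \<in> A T. X a > R})"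
      using fin[of T] by (simp add: sum_distrib_left[symmetric] sum.If_cases Int_def)
    finally show ?thesis by (simp add: s_def sum_distrib_right[symmetric])
  qed
  have int_s: "integral\<^sup>L lborel (s T) = 1 / real (card (A T)) * (\<Sum>a\<in>A T. X a ^ k)" for T
  proof -
    have "integral\<^sup>L lborel (s T) = 1 / real (card (A T)) *
        (\<integral>R. (\<Sum>a\<in>A T. indicator {0..<X a} R * (real k * R ^ (k - 1))) \<partial>lborel)"
      unfolding s_def by (rule integral_mult_right_zero)
    also have "(\<integral>R. (\<Sum>a\<in>A T. indicator {0..<X a} R * (real k * R ^ (k - 1))) \<partial>lborel) =
        (\<Sum>a\<in>A T. \<integral>R. indicator {0..<X a} R * (real k * R ^ (k - 1)) \<partial>lborel)"
      by (intro Bochner_Integration.integral_sum integral_power_tail(1)[OF nonneg k])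
    also have "\<dots> = (\<Sum>a\<in>A T. X a ^ k)"
      by (intro sum.cong refl integral_power_tail(2)[OF nonneg k])
    finally show ?thesis .
  qed
  have f_meas: "f \<in> borel_measurable lborel"
  proof -
    have "continuous_on {0..} (\<lambda>R. real k * R ^ (k - 1) * \<Psi> R)" using cont by (intro continuous_intros)
    then have "(\<lambda>R. indicator {0..} R *\<^sub>R (real k * R ^ (k - 1) * \<Psi> R)) \<in> borel_measurable borel"
      by (intro borel_measurable_continuous_on_indicator) auto
    then show ?thesis unfolding f_def by simp
  qed
  have "((\<lambda>T. integral\<^sup>L lborel (s T)) \<longlongrightarrow> integral\<^sup>L lborel f) at_top"
  proof (rule integral_dominated_convergence_at_top[where w = w])
    show "integrable lborel w"
      unfolding w_def using k
      by (intro Bochner_Integration.integrable_add integrable_mult_right integrable_powr_tail integral_power_tail) auto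
    show "AE R in lborel. ((\<lambda>T. s T R) \<longlongrightarrow> f R) at_top"
    proof (rule AE_I2)
      fix R :: real
      show "((\<lambda>T. s T R) \<longlongrightarrow> f R) at_top"
      proof (cases "R \<ge> 0")
        case True
        then show ?thesis unfolding s_eq f_def by (intro tendsto_intros lim)
      qed (simp add: s_eq f_def)
    qed
    show "\<forall>\<^sub>F T in at_top. AE R in lborel. norm (s T R) \<le> w R"
      using tail
    proof eventually_elim
      fix T
      assume T: "\<forall>R\<ge>1. real (card {a \<in> A T. X a > R}) / real (card (A T)) \<le> B * R powr - (real k + 1 / 4)"
      show "AE R in lborel. norm (s T R) \<le> w R"
      proof (rule AE_I2)
        fix R :: real
        define p where "p = real (card {a \<in> A T. X a > R}) / real (card (A T))"
        have p: "0 \<le> p" by (simp add: p_def)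
        consider "R < 0" | "0 \<le> R" "R < 1" | "R \<ge> 1" by linarith
        then show "norm (s T R) \<le> w R"
        proof cases
          case 1
          then show ?thesis by (simp add: s_eq w_def)
        next
          case 2
          have "card {a \<in> A T. X a > R} \<le> card (A T)" using fin by (intro card_mono) auto
          then have "p \<le> 1" by (auto simp: p_def divide_le_eq)
          then have "real k * R ^ (k - 1) * p \<le> real k * R ^ (k - 1) * 1" using 2 by (intro mult_left_mono) auto
          then show ?thesis using 2 p unfolding s_eq p_def[symmetric] by (simp add: w_def abs_mult)
        next
          case 3
          have "real k * R ^ (k - 1) * p \<le> real k * R ^ (k - 1) * (B * R powr - (real k + 1 / 4))"
            using T 3 by (intro mult_left_mono) (auto simp: p_def)
          also have pow: "R ^ (k - 1) = R powr (real k - 1)" using 3 k by (simp add: powr_realpow[symmetric] of_nat_diff)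
          also have "real k * R powr (real k - 1) * (B * R powr - (real k + 1 / 4)) =
              real k * B * (R powr (real k - 1) * R powr - (real k + 1 / 4))" by simp
          also have "R powr (real k - 1) * R powr - (real k + 1 / 4) = R powr (-5 / 4)"
            unfolding powr_add[symmetric] by simp
          finally show ?thesis using 3 p unfolding s_eq p_def[symmetric] pow by (simp add: w_def abs_mult)
        qed
      qed
    qed
  qed (use f_meas in \<open>auto simp: s_def[abs_def]\<close>)
  moreover have "integral\<^sup>L lborel f = limit_moment \<Psi> k"
    unfolding f_def limit_moment_def set_lebesgue_integral_def
    by (simp add: integral_mult_right_zero[symmetric] mult_ac del: integral_mult_right_zero)
  ultimately show ?thesis unfolding int_s by simp
qed

section \<open>Vectors with very unequal entries\<close>

text \<open>Comparison with the integral: by the mean value theorem the antiderivative grows by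
  \<open>z powr - s\<close> with \<open>z < Suc Y\<close>. The step from 0 is separate, as the
  derivative formula fails there.\<close>

lemma sum_powr_minus_le:
  fixes s :: real
  assumes s: "0 < s" "s < 1"
  shows "(\<Sum>x\<in>{1..Y}. real x powr - s) \<le> real Y powr (1 - s) / (1 - s)"
proof (induction Y)
  case (Suc Y)
  have "real (Suc Y) powr - s \<le> real (Suc Y) powr (1 - s) / (1 - s) - real Y powr (1 - s) / (1 - s)"
  proof (cases "Y = 0")
    case True
    then show ?thesis using s by simp
  next
    case False
    have "\<exists>z. real Y < z \<and> z < real (Suc Y) \<and>
        real (Suc Y) powr (1 - s) / (1 - s) - real Y powr (1 - s) / (1 - s) = (real (Suc Y) - real Y) * z powr - s"
    proof (rule MVT2)
      fix x assume "real Y \<le> x"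
      then show "((\<lambda>x. x powr (1 - s) / (1 - s)) has_real_derivative x powr - s) (at x)"
        using False s by (auto intro!: derivative_eq_intros)
    qed simp
    then obtain z where z: "real Y < z" "z < real (Suc Y)"
      "real (Suc Y) powr (1 - s) / (1 - s) - real Y powr (1 - s) / (1 - s) = z powr - s" by auto
    have "real (Suc Y) powr - s \<le> z powr - s" using z False s by (intro powr_mono2') auto
    then show ?thesis using z(3) by simp
  qed
  then show ?case using Suc by simp
qed simp

lemma sum_prod_vec:
  fixes g :: "'b \<Rightarrow> 'c :: comm_semiring_1"
  assumes "finite S"
  shows "(\<Sum>a :: 'b ^ 'd::finite | \<forall>i. a $ i \<in> S. \<Prod>i\<in>UNIV. g (a $ i)) = (\<Sum>x\<in>S. g x) ^ CARD('d)"
proof -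
  have "(\<Sum>a :: 'b ^ 'd | \<forall>i. a $ i \<in> S. \<Prod>i\<in>UNIV. g (a $ i)) = (\<Sum>f\<in>PiE (UNIV :: 'd set) (\<lambda>_. S). \<Prod>i\<in>UNIV. g (f i))"
    by (rule sum.reindex_bij_witness[of _ vec_lambda vec_nth]) (auto simp: vec_eq_iff)
  also have "\<dots> = (\<Prod>i\<in>(UNIV :: 'd set). \<Sum>x\<in>S. g x)"
    using assms by (intro prod_sum_PiE[symmetric]) auto
  finally show ?thesis by simp
qed

text \<open>Markov's inequality for the moment of order \<open>n - 1 / 2\<close>, which is bounded
  because \<open>x powr (1 / (2 * n) - 1)\<close>, summed over \<open>x \<le> Y\<close>, is only \<open>O(Y powr (1 / (2 * n)))\<close>.\<close>
lemma card_skew_vecs_le: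
  fixes Y :: nat and r :: real
  assumes card: "CARD('d::finite) \<ge> 2" and r: "r > 0"
  defines "n \<equiv> real CARD('d) - 1"
  defines "A \<equiv> {a :: nat ^ 'd. a \<in> prim_vecs \<and> (\<forall>i. a $ i \<le> Y) \<and>
    r * (\<Prod>i\<in>UNIV. real (a $ i)) powr (1 / n) < real (max_entry a) powr (real CARD('d) / n)}"
  shows "finite A" "real (card A) \<le> (2 * n * real Y) ^ CARD('d) / r powr (n - 1 / 2)"
proof -
  \<comment> \<open>Chosen so that \<open>n * s\<close> is the order \<open>n - 1 / 2\<close> of the
    moment, while \<open>s < 1\<close> keeps the sum of \<open>x powr - s\<close> of order
    \<open>Y powr (1 - s)\<close>.\<close>
  define s where "s = 1 - 1 / (2 * n)"
  have n: "n \<ge> 1" using card by (simp add: n_def)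
  have s: "0 < s" "s < 1" "n * s = n - 1 / 2" using n by (auto simp: s_def field_simps)
  define Z where "Z = {a :: nat ^ 'd. \<forall>i. a $ i \<in> {1..Y}}"
  have fin: "finite Z" unfolding Z_def by (rule vec_components_in(1)) simp
  have sub: "A \<subseteq> Z" by (auto simp: A_def Z_def prim_vecs_def Suc_le_eq)
  then show "finite A" using fin by (rule finite_subset)
  have "r powr (n - 1 / 2) \<le> (\<Prod>i\<in>UNIV. real Y powr s * real (a $ i) powr - s)" if a: "a \<in> A" for a
  proof -
    have pos: "a $ i > 0" for i using a by (simp add: A_def prim_vecs_def)
    have le: "max_entry a \<le> Y" using a max_entry_eq[of a] by (metis (mono_tags, lifting) A_def mem_Collect_eq)
    define P where "P = (\<Prod>i\<in>UNIV. real (a $ i))"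
    have P: "P > 0" unfolding P_def using pos by (intro prod_pos) auto
    have "r * P powr (1 / n) < real (max_entry a) powr (real CARD('d) / n)" using a by (simp add: A_def P_def)
    also have "\<dots> \<le> real Y powr (real CARD('d) / n)" using le n by (intro powr_mono2) auto
    \<comment> \<open>Raising to the power \<open>n * s\<close> turns the product into a product of
      \<open>s\<close>th powers, which separates the coordinates.\<close>
    finally have "(r * P powr (1 / n)) powr (n * s) \<le> (real Y powr (real CARD('d) / n)) powr (n * s)"
      using n s r by (intro powr_mono2) auto
    then have "r powr (n - 1 / 2) * P powr s \<le> (real Y powr s) powr real CARD('d)"
      using n r by (simp add: powr_mult powr_powr s(3)[symmetric] mult.commute)
    then have "r powr (n - 1 / 2) \<le> (real Y powr s) powr real CARD('d) * P powr - s"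
      using P by (simp add: powr_minus field_simps)
    also have "(real Y powr s) powr real CARD('d) = (\<Prod>i\<in>(UNIV :: 'd set). real Y powr s)"
    proof -
      have "Y > 0" using le pos[of undefined] max_entry_ge[of a undefined] by linarith
      then show ?thesis by (simp add: powr_realpow)
    qed
    also have "P powr - s = (\<Prod>i\<in>UNIV. real (a $ i) powr - s)"
      unfolding P_def by (rule prod_powr_distrib)
    finally show ?thesis by (simp add: prod.distrib)
  qed
  then have "(\<Sum>a\<in>A. r powr (n - 1 / 2)) \<le> (\<Sum>a\<in>A. \<Prod>i\<in>UNIV. real Y powr s * real (a $ i) powr - s)"
    by (rule sum_mono)
  \<comment> \<open>Enlarging \<open>A\<close> to the full box makes the sum a power of a
    one-dimensional sum.\<close>
  also have "\<dots> \<le> (\<Sum>a\<in>Z. \<Prod>i\<in>UNIV. real Y powr s * real (a $ i) powr - s)"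
    using fin sub by (intro sum_mono2) (auto intro!: prod_nonneg)
  also have "\<dots> = (\<Sum>x\<in>{1..Y}. real Y powr s * real x powr - s) ^ CARD('d)"
    unfolding Z_def by (rule sum_prod_vec) simp
  also have "\<dots> \<le> (2 * n * real Y) ^ CARD('d)"
  proof (rule power_mono)
    have "(\<Sum>x\<in>{1..Y}. real Y powr s * real x powr - s) \<le> real Y powr s * (real Y powr (1 - s) / (1 - s))"
      unfolding sum_distrib_left[symmetric] using sum_powr_minus_le[OF s(1,2)] by (intro mult_left_mono) auto
    also have "\<dots> = real Y powr s * real Y powr (1 - s) * (2 * n)" using n by (simp add: s_def)
    also have "real Y powr s * real Y powr (1 - s) = real Y" unfolding powr_add[symmetric] by simp
    finally show "(\<Sum>x\<in>{1..Y}. real Y powr s * real x powr - s) \<le> 2 * n * real Y" by (simp add: mult_ac)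
  qed (auto intro: sum_nonneg)
  finally show "real (card A) \<le> (2 * n * real Y) ^ CARD('d) / r powr (n - 1 / 2)"
    using r by (simp add: field_simps)
qed

section \<open>The tail bounds in the two cases and the conclusion\<close>

text \<open>Each coordinate attains a positive minimum on the compact closure.\<close>

lemma positive_closure_imp_bounded_below:
  fixes D :: "(real ^ 'd::finite) set"
  assumes "bounded D" "D \<noteq> {}" "closure D \<subseteq> {x. \<forall>i. 0 < x $ i}"
  obtains c where "c > 0" "\<And>x i. x \<in> D \<Longrightarrow> c \<le> x $ i"
proof -
  have "\<exists>m>0. \<forall>x\<in>closure D. m \<le> x $ i" for i
  proof -
    have "\<exists>x\<in>closure D. \<forall>y\<in>closure D. x $ i \<le> y $ i"
      using assms(1,2) by (intro continuous_attains_inf continuous_intros) (auto simp: compact_closure)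
    then show ?thesis using assms(3) by blast
  qed
  then obtain m where m: "\<And>i. m i > 0" "\<And>i x. x \<in> closure D \<Longrightarrow> m i \<le> x $ i" by metis
  show thesis
  proof (rule that[of "Min (range m)"])
    show "Min (range m) > 0" using m(1) by simp
    fix x i assume "x \<in> D"
    then have "m i \<le> x $ i" using m(2) closure_subset by blast
    moreover have "Min (range m) \<le> m i" by simp
    ultimately show "Min (range m) \<le> x $ i" by linarith
  qed
qed

lemma less_normalized_f_iff:
  assumes "a \<in> prim_vecs"
  shows "R < normalized_f (a :: nat ^ 'd::finite) \<longleftrightarrow>
    R * (\<Prod>i\<in>UNIV. real (a $ i)) powr (1 / (real CARD('d) - 1)) < of_int (frobenius_f a)"
proof -
  have "(\<Prod>i\<in>UNIV. real (a $ i)) > 0" using assms by (intro prod_pos) (auto simp: prim_vecs_def)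
  then show ?thesis unfolding normalized_f_def by (intro pos_less_divide_eq) (metis less_irrefl powr_gt_zero)
qed

theorem corollary2:
  fixes D :: "(real ^ 'd::finite) set" and \<Psi> :: "real \<Rightarrow> real"
  assumes "CARD('d) \<ge> 3"
    and "frobenius_limit_distribution TYPE('d) \<Psi>"
    and "D \<subseteq> {x. \<forall>i. 0 \<le> x $ i}" and "bounded D"
    and "interior D \<noteq> {}" and "frontier D \<in> null_sets lebesgue"
  shows "(\<forall>k::nat. 1 \<le> k \<and> int k \<le> \<lfloor>real CARD('d) / 2 - 1\<rfloor> \<longrightarrow>
            ((\<lambda>T::real. 1 / real (card (prim_vecs_in (scaleR T ` D))) *
                    (\<Sum>a\<in>prim_vecs_in (scaleR T ` D). normalized_f a ^ k))
              \<longlongrightarrow> limit_moment \<Psi> k) at_top) \<and>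
         (closure D \<subseteq> {x. \<forall>i. 0 < x $ i} \<longrightarrow>
          (\<forall>k::nat. 1 \<le> k \<and> k \<le> CARD('d) - 2 \<longrightarrow>
            ((\<lambda>T::real. 1 / real (card (prim_vecs_in (scaleR T ` D))) *
                    (\<Sum>a\<in>prim_vecs_in (scaleR T ` D). normalized_f a ^ k))
              \<longlongrightarrow> limit_moment \<Psi> k) at_top))"
proof -
  define A where "A T = prim_vecs_in (scaleR T ` D)" for T
  define N where "N = CARD('d) - 1"
  define n where "n = real CARD('d) - 1"
  have card2: "CARD('d) \<ge> 2" and N: "real N = n" "n \<ge> 2" "CARD('d) = Suc N"
    using assms(1) by (auto simp: N_def n_def of_nat_diff)
  have prim: "a \<in> prim_vecs" if "a \<in> A T" for a T using that by (simp add: A_def prim_vecs_in_def)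
  obtain L where L: "L > 0" and A_le: "\<And>T a i. a \<in> A T \<Longrightarrow> real (a $ i) \<le> L * \<bar>T\<bar>"
    and fin: "\<And>T. finite (A T)"
    unfolding A_def by (rule prim_vecs_in_bounded[OF \<open>bounded D\<close>]) blast
  obtain c where c: "c > 0" and A_card: "\<forall>\<^sub>F T in at_top. c * T ^ CARD('d) \<le> real (card (A T))"
    unfolding A_def by (rule card_prim_vecs_in_ge[OF assms(1,3-5)]) blast
  obtain K where K: "K > 0" and F: "\<And>Y R. R > 0 \<Longrightarrow>
      finite {a :: nat ^ 'd. a \<in> prim_vecs \<and> (\<forall>i. a $ i \<le> Y) \<and>
        R * real (max_entry a) powr (real CARD('d) / n) < of_int (frobenius_f a)} \<and>
      real (card {a :: nat ^ 'd. a \<in> prim_vecs \<and> (\<forall>i. a $ i \<le> Y) \<and>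
        R * real (max_entry a) powr (real CARD('d) / n) < of_int (frobenius_f a)})
      \<le> K * real Y ^ CARD('d) / R ^ N"
    unfolding n_def N_def by (rule card_large_frobenius_f[OF card2]) blast
  define Y where "Y T = nat \<lfloor>L * T\<rfloor>" for T
  have Y: "real (Y T) ^ CARD('d) \<le> L ^ CARD('d) * T ^ CARD('d)" if "T > 0" for T
  proof -
    have "real (Y T) \<le> L * T" using L that by (simp add: Y_def)
    then show ?thesis unfolding power_mult_distrib[symmetric] by (intro power_mono) auto
  qed
  have A_Y: "a $ i \<le> Y T" if "a \<in> A T" "T > 0" for a T i
    using A_le[OF that(1), of i] that(2) by (simp add: Y_def le_nat_floor)
  have Y_pow: "K' * real (Y T) ^ CARD('d) / r \<le> K' * L ^ CARD('d) * T ^ CARD('d) / r"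
    if "K' > 0" "r > 0" "T > 0" for K' r T
    using mult_left_mono[OF Y[OF that(3)], of K'] that by (intro divide_right_mono) auto
  \<comment> \<open>Both cases reduce to a bound on the number of vectors in the tail; dividing by
    \<open>c * T ^ d\<close> gives the hypothesis of \<open>moments_converge\<close>.\<close>
  have limit: "((\<lambda>T. 1 / real (card (A T)) * (\<Sum>a\<in>A T. normalized_f a ^ k)) \<longlongrightarrow> limit_moment \<Psi> k) at_top"
    if k: "1 \<le> k" and tail: "\<And>T R. T > 0 \<Longrightarrow> R \<ge> 1 \<Longrightarrow>
      real (card {a \<in> A T. R < normalized_f a}) \<le> B * T ^ CARD('d) * R powr - (real k + 1 / 4)" for k B
  proof (rule moments_converge[OF k fin, where B = "B / c"])
    show "0 \<le> normalized_f a" if "a \<in> A T" for T a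
      using frobenius_f_nonneg[OF prim[OF that]] by (simp add: normalized_f_def)
    show "continuous_on {0..} \<Psi>" using assms(2) by (simp add: frobenius_limit_distribution_def)
    have "admissible_domain D" using assms by (simp add: admissible_domain_def)
    then show "((\<lambda>T. real (card {a \<in> A T. R < normalized_f a}) / real (card (A T))) \<longlongrightarrow> \<Psi> R) at_top" if "0 \<le> R" for R
      using assms(2)[unfolded frobenius_limit_distribution_def] that unfolding A_def by (elim conjE) simp
    show "\<forall>\<^sub>F T in at_top. \<forall>R\<ge>1. real (card {a \<in> A T. R < normalized_f a}) / real (card (A T))
        \<le> B / c * R powr - (real k + 1 / 4)"
      using A_card eventually_gt_at_top[of 0]
    proof eventually_elim
      case (elim T)
      show ?case
      proof (intro allI impI)
        fix R :: real assume R: "R \<ge> 1"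
        have pos: "c * T ^ CARD('d) > 0" using elim(2) c by simp
        then have "real (card {a \<in> A T. R < normalized_f a}) / real (card (A T)) \<le>
            real (card {a \<in> A T. R < normalized_f a}) / (c * T ^ CARD('d))"
          using elim(1) by (intro divide_left_mono) (linarith, simp, rule mult_pos_pos, linarith+)
        also have "\<dots> \<le> B * T ^ CARD('d) * R powr - (real k + 1 / 4) / (c * T ^ CARD('d))"
          using tail[OF elim(2) R] pos by (intro divide_right_mono) linarith+
        also have "\<dots> = B / c * R powr - (real k + 1 / 4)" using elim(2) by simp
        finally show "real (card {a \<in> A T. R < normalized_f a}) / real (card (A T)) \<le> B / c * R powr - (real k + 1 / 4)" .
      qed
    qed
  qed
  show ?thesis
  proof (intro conjI allI impI; (elim conjE)?)
    fix k :: nat assume k: "1 \<le> k" "int k \<le> \<lfloor>real CARD('d) / 2 - 1\<rfloor>"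
    \<comment> \<open>From \<open>k <= d / 2 - 1\<close> and \<open>d = n + 1\<close>.\<close>
    have kn: "real k + 1 / 2 \<le> n / 2" using k(2) unfolding le_floor_iff n_def by simp
    show "((\<lambda>T. 1 / real (card (prim_vecs_in (scaleR T ` D))) *
        (\<Sum>a\<in>prim_vecs_in (scaleR T ` D). normalized_f a ^ k)) \<longlongrightarrow> limit_moment \<Psi> k) at_top"
      unfolding A_def[symmetric]
    proof (rule limit[OF k(1), where B = "(K + (2 * n) ^ CARD('d)) * L ^ CARD('d)"])
      fix T R :: real assume T: "T > 0" and R: "R \<ge> 1"
      define X1 where "X1 = {a :: nat ^ 'd. a \<in> prim_vecs \<and> (\<forall>i. a $ i \<le> Y T) \<and>
        sqrt R * real (max_entry a) powr (real CARD('d) / n) < of_int (frobenius_f a)}"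
      define X2 where "X2 = {a :: nat ^ 'd. a \<in> prim_vecs \<and> (\<forall>i. a $ i \<le> Y T) \<and>
        sqrt R * (\<Prod>i\<in>UNIV. real (a $ i)) powr (1 / n) < real (max_entry a) powr (real CARD('d) / n)}"
      have sub: "{a \<in> A T. R < normalized_f a} \<subseteq> X1 \<union> X2"
      proof
        fix a assume a: "a \<in> {a \<in> A T. R < normalized_f a}"
        define P where "P = (\<Prod>i\<in>UNIV. real (a $ i)) powr (1 / n)"
        define m where "m = real (max_entry a) powr (real CARD('d) / n)"
        have "R * P < of_int (frobenius_f a)"
          using a less_normalized_f_iff[OF prim, of a T R] by (simp add: P_def n_def)
        \<comment> \<open>The factor \<open>R\<close> is split evenly: either \<open>m\<close>
          exceeds \<open>sqrt R * P\<close>, or \<open>frobenius_f a\<close> exceeds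
          \<open>sqrt R * m\<close>.\<close>
        moreover have "sqrt R * m \<le> R * P" if "m \<le> sqrt R * P"
          using mult_left_mono[OF that, of "sqrt R"] R by (simp add: mult.assoc[symmetric])
        ultimately have "sqrt R * m < of_int (frobenius_f a) \<or> sqrt R * P < m" by linarith
        then show "a \<in> X1 \<union> X2" using a prim A_Y T unfolding X1_def X2_def P_def m_def by blast
      qed
      have sR: "sqrt R > 0" using R by simp
      have X1: "finite X1" "real (card X1) \<le> K * real (Y T) ^ CARD('d) / sqrt R ^ N"
        using F[OF sR] unfolding X1_def by blast+
      have X2: "finite X2" "real (card X2) \<le> (2 * n * real (Y T)) ^ CARD('d) / sqrt R powr (n - 1 / 2)"
        unfolding X2_def n_def by (rule card_skew_vecs_le[OF card2 sR])+
      have sqrt_powr: "sqrt R powr x = R powr (x / 2)" for x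
        using powr_powr[of R "1 / 2" x] R by (simp add: powr_half_sqrt)
      have "sqrt R ^ N = R powr (n / 2)"
        using powr_realpow[OF sR, of N] by (simp add: sqrt_powr N(1))
      then have p1: "1 / sqrt R ^ N \<le> R powr - (real k + 1 / 4)"
        using R kn by (simp add: powr_minus_divide[symmetric] powr_mono)
      \<comment> \<open>The moment of order \<open>n - 1 / 2\<close> at the threshold
        \<open>sqrt R\<close> decays with exponent \<open>n / 2 - 1 / 4\<close>, and
        \<open>kn\<close> makes this at least \<open>k + 1 / 4\<close>.\<close>
      have "sqrt R powr (n - 1 / 2) = R powr (n / 2 - 1 / 4)"
        unfolding sqrt_powr by (simp add: diff_divide_distrib)
      then have p2: "1 / sqrt R powr (n - 1 / 2) \<le> R powr - (real k + 1 / 4)"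
        using R kn by (simp add: powr_minus_divide[symmetric] powr_mono)
      have "card {a \<in> A T. R < normalized_f a} \<le> card (X1 \<union> X2)"
        using X1(1) X2(1) by (intro card_mono[OF _ sub]) simp
      also have "\<dots> \<le> card X1 + card X2" by (rule card_Un_le)
      finally have "real (card {a \<in> A T. R < normalized_f a}) \<le> real (card X1) + real (card X2)" by linarith
      also have "\<dots> \<le> K * L ^ CARD('d) * T ^ CARD('d) / sqrt R ^ N +
          (2 * n) ^ CARD('d) * L ^ CARD('d) * T ^ CARD('d) / sqrt R powr (n - 1 / 2)"
        using X1(2) X2(2) Y_pow[OF K _ T, of "sqrt R ^ N"] Y_pow[of "(2 * n) ^ CARD('d)", OF _ _ T, of "sqrt R powr (n - 1 / 2)"] N R
        unfolding power_mult_distrib[of "2 * n"] by (intro add_mono) auto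
      also have "\<dots> \<le> K * L ^ CARD('d) * T ^ CARD('d) * R powr - (real k + 1 / 4) +
          (2 * n) ^ CARD('d) * L ^ CARD('d) * T ^ CARD('d) * R powr - (real k + 1 / 4)"
        using mult_left_mono[OF p1, of "K * L ^ CARD('d) * T ^ CARD('d)"]
          mult_left_mono[OF p2, of "(2 * n) ^ CARD('d) * L ^ CARD('d) * T ^ CARD('d)"] K L T N
        by (intro add_mono) auto
      finally show "real (card {a \<in> A T. R < normalized_f a}) \<le>
          (K + (2 * n) ^ CARD('d)) * L ^ CARD('d) * T ^ CARD('d) * R powr - (real k + 1 / 4)"
        by (simp add: algebra_simps)
    qed
  next
    fix k :: nat assume pos: "closure D \<subseteq> {x. \<forall>i. 0 < x $ i}" and k: "1 \<le> k" "k \<le> CARD('d) - 2"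
    have "D \<noteq> {}" using assms(5) by auto
    then obtain l where l: "l > 0" "\<And>x i. x \<in> D \<Longrightarrow> l \<le> x $ i"
      using positive_closure_imp_bounded_below[OF \<open>bounded D\<close> _ pos] by blast
    \<comment> \<open>All entries lie between \<open>l * T\<close> and \<open>L * T\<close>, so the
      normalization is at least \<open>\<kappa>\<close> times the power of the largest
      entry.\<close>
    define \<kappa> where "\<kappa> = (l / L) powr (real CARD('d) / n)"
    have \<kappa>: "\<kappa> > 0" using l L by (simp add: \<kappa>_def)
    \<comment> \<open>Here the full decay exponent \<open>n = d - 1\<close> is available, and
      \<open>k <= d - 2\<close> leaves room for the extra 1 / 4.\<close>
    have kn: "real k + 1 / 4 \<le> n" using k by (simp add: n_def)
    show "((\<lambda>T. 1 / real (card (prim_vecs_in (scaleR T ` D))) *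
        (\<Sum>a\<in>prim_vecs_in (scaleR T ` D). normalized_f a ^ k)) \<longlongrightarrow> limit_moment \<Psi> k) at_top"
      unfolding A_def[symmetric]
    proof (rule limit[OF k(1), where B = "K * L ^ CARD('d) / \<kappa> ^ N"])
      fix T R :: real assume T: "T > 0" and R: "R \<ge> 1"
      define X where "X = {a :: nat ^ 'd. a \<in> prim_vecs \<and> (\<forall>i. a $ i \<le> Y T) \<and>
        (R * \<kappa>) * real (max_entry a) powr (real CARD('d) / n) < of_int (frobenius_f a)}"
      have sub: "{a \<in> A T. R < normalized_f a} \<subseteq> X"
      proof
        fix a assume a: "a \<in> {a \<in> A T. R < normalized_f a}"
        then have aA: "a \<in> A T" by simp
        have a_ge: "l * T \<le> real (a $ i)" for i
        proof -
          have "(\<chi> i. real (a $ i)) \<in> scaleR T ` D" using aA by (simp add: A_def prim_vecs_in_def)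
          then obtain x where x: "(\<chi> i. real (a $ i)) = T *\<^sub>R x" "x \<in> D" by (rule imageE)
          then have "real (a $ i) = T * x $ i" by (simp add: vec_eq_iff)
          then show ?thesis using l(2)[OF x(2), of i] T by (simp add: mult.commute)
        qed
        obtain j where j: "a $ j = max_entry a" by (rule max_entry_eq)
        have "\<kappa> * real (max_entry a) powr (real CARD('d) / n) \<le> \<kappa> * (L * T) powr (real CARD('d) / n)"
          using A_le[OF aA, of j] j T \<kappa> N by (intro mult_left_mono powr_mono2) auto
        also have "\<dots> = (l * T) powr (real CARD('d) / n)"
          using l L T by (simp add: \<kappa>_def powr_mult[symmetric])
        also have "\<dots> = (\<Prod>i\<in>(UNIV :: 'd set). l * T) powr (1 / n)"
          using l T by (simp add: powr_realpow[symmetric] powr_powr)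
        also have "\<dots> \<le> (\<Prod>i\<in>UNIV. real (a $ i)) powr (1 / n)"
          using a_ge l T N by (intro powr_mono2 prod_mono prod_nonneg) auto
        finally have "R * (\<kappa> * real (max_entry a) powr (real CARD('d) / n)) \<le>
            R * (\<Prod>i\<in>UNIV. real (a $ i)) powr (1 / n)" using R by (intro mult_left_mono) auto
        also have "\<dots> < of_int (frobenius_f a)"
          using a less_normalized_f_iff[OF prim[OF aA], of R] by (simp add: n_def)
        finally show "a \<in> X" using aA prim A_Y T unfolding X_def by (simp add: mult.assoc)
      qed
      have R\<kappa>: "R * \<kappa> > 0" using R \<kappa> by simp
      have X: "finite X" "real (card X) \<le> K * real (Y T) ^ CARD('d) / (R * \<kappa>) ^ N"
        using F[OF R\<kappa>] unfolding X_def by blast+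
      have "real (card {a \<in> A T. R < normalized_f a}) \<le> real (card X)"
        using card_mono[OF X(1) sub] by simp
      also note X(2)
      also have "K * real (Y T) ^ CARD('d) / (R * \<kappa>) ^ N \<le> K * L ^ CARD('d) * T ^ CARD('d) / (R * \<kappa>) ^ N"
        using R\<kappa> by (intro Y_pow K T) simp
      also have "\<dots> = K * L ^ CARD('d) / \<kappa> ^ N * T ^ CARD('d) * R powr - n"
        using R N(1) by (simp add: power_mult_distrib powr_minus_divide powr_realpow[symmetric])
      also have "\<dots> \<le> K * L ^ CARD('d) / \<kappa> ^ N * T ^ CARD('d) * R powr - (real k + 1 / 4)"
        using R kn K L T \<kappa> by (intro mult_left_mono powr_mono) auto
      finally show "real (card {a \<in> A T. R < normalized_f a}) \<le>
          K * L ^ CARD('d) / \<kappa> ^ N * T ^ CARD('d) * R powr - (real k + 1 / 4)" .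
    qed
  qed
qed

end
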